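(* Let $\alpha>0$, $\beta\in\mathbb{R}$. Suppose $(n_q,k_q)_{q\ge1}$ is a Stoltz sequence, and let $k$ be any non-negative integer. Then the following statement is equivalent to the Lindelöf Hypothesis: for every natural number $l\ge1$, $$\lim_{q\to\infty}\frac1{k_q}\sum_{j=1}^{k_q}\left|\zeta^{(k)}\left(\tfrac12+iT_{\alpha,\beta}^{n_q+j}(x)\right)\right|^{l}=\frac{\alpha}{\pi}\int_{\mathbb{R}}\frac{|\zeta^{(k)}(\frac12+i\tau)|^{l}}{\alpha^2+(\tau-\beta)^2}\,d\tau$$ (an equality of finite real numbers) for $\mu_{\alpha,\beta}$-almost all $x\in\mathbb{R}$.
   Context: $\zeta^{(k)}$ is the $k$-th derivative of the Riemann zeta function ($\zeta^{(0)}=\zeta$). The Lindelöf Hypothesis is the assertion that for every $\epsilon>0$, $|\zeta(\frac12+it)|=O(|t|^{\epsilon})$ as $|t|\to\infty$. For $\alpha>0$ and $\beta\in\mathbb{R}$, $T_{\alpha,\beta}:\mathbb{R}\to\mathbb{R}$ is the map $T_{\alpha,\beta}(x)=\frac{\alpha}{2}\left(\frac{x+\beta}{\alpha}-\frac{\alpha}{x-\beta}\right)$ if $x\ne\beta$, and $T_{\alpha,\beta}(\beta)=\beta$; $T_{\alpha,\beta}^{j}$ denotes its $j$-th iterate. It preserves, and is ergodic for, the probability measure $\mu_{\alpha,\beta}(A)=\frac{\alpha}{\pi}\int_A\frac{dt}{\alpha^2+(t-\beta)^2}$. Stoltz sequences. For a set $Z\subseteq\mathbb{Z}\times\mathbb{N}$,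 put $Z^h=\{(n,k)\in Z:k\ge h\}$, $Z^h_{\alpha}=\{(z,s)\in\mathbb{Z}^2:|z-y|<\alpha(s-r)\text{ for some }(y,r)\in Z^h\}$, and $Z^h_{\alpha}(\lambda)=\{n:(n,\lambda)\in Z^h_{\alpha}\}$ for $\lambda\in\mathbb{N}$. A sequence of pairs of natural numbers $(n_l,k_l)_{l\ge1}$ is Stoltz if there exist a set $Z\subseteq\mathbb{Z}\times\mathbb{N}$ and a function $h=h(t)$ tending to infinity with $t$ such that $(n_l,k_l)\in Z^{h(t)}$ for all $l\ge t$, and there exist $h_0$, $\alpha_0>0$ and $A>0$ such that $|Z^{h_0}_{\alpha_0}(\lambda)|\le A\lambda$ for all integers $\lambda>0$. *)

theory Defs
  imports
    "HOL-Complex_Analysis.Complex_Analysis"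
    "HOL-Probability.Probability"
    "HOL-Library.Landau_Symbols"
begin

section \<open>The Riemann zeta function\<close>

text \<open>
  The library has no zeta function.  It is defined as the analytic continuation of its Dirichlet
  series to the plane punctured at 1; the value at the pole is irrelevant and is set to 0.
  That this continuation exists and is unique is proved below.
\<close>

definition is_zeta_continuation :: "(complex \<Rightarrow> complex) \<Rightarrow> bool" where
  "is_zeta_continuation f \<longleftrightarrow>
     f holomorphic_on (- {1}) \<and>
     (\<forall>s. Re s > 1 \<longrightarrow> (\<lambda>n. of_nat (Suc n) powr (- s)) sums f s) \<and>
     f 1 = 0"

definition zeta :: "complex \<Rightarrow> complex" where
  "zeta = (THE f. is_zeta_continuation f)"

lemma is_zeta_continuation_unique:
  assumes "is_zeta_continuation f" "is_zeta_continuation g"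
  shows   "f = g"
proof
  fix z :: complex
  show "f z = g z"
  proof (cases "z = 1")
    case True
    then show ?thesis using assms by (simp add: is_zeta_continuation_def)
  next
    case False
    show ?thesis
    proof (rule analytic_continuation_open[where s = "{s. Re s > 1}" and s' = "- {1}" and f = f and g = g])
      show "open {s. Re s > 1}" by (rule open_halfspace_Re_gt)
      show "{s. Re s > 1} \<noteq> {}" by (auto intro!: exI[of _ 2])
      show "connected (- {1 :: complex})" by (rule connected_punctured_universe) simp
      show "f s = g s" if "s \<in> {s. Re s > 1}" for s
        using that assms unfolding is_zeta_continuation_def mem_Collect_eq by (meson sums_unique2)
      show "{s. Re s > 1} \<subseteq> - {1}" by auto
    qed (use assms False in \<open>simp_all add: is_zeta_continuation_def open_Compl\<close>)
  qed
qed

text \<open>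
  Existence: expanding \<open>(m + 1) powr (1 - s)\<close> by Taylor's formula at \<open>m\<close> to order \<open>K\<close> and summing
  over \<open>m\<close> expresses \<open>(s - 1) * zeta s\<close> through its values at \<open>s + 1\<close>, ..., \<open>s + K - 1\<close>, up to
  a remainder that is holomorphic for \<open>Re s > 1 - K\<close>.
\<close>

definition ffac :: "nat \<Rightarrow> complex \<Rightarrow> complex" where
  "ffac i a = (\<Prod>j<i. a - of_nat j)"

definition zrem :: "nat \<Rightarrow> nat \<Rightarrow> complex \<Rightarrow> complex" where
  "zrem K m s = of_nat (Suc (Suc m)) powr (1 - s)
     - (\<Sum>i\<le>K. ffac i (1 - s) * of_nat (Suc m) powr (1 - s - of_nat i) / fact i)"

definition zseries :: "complex \<Rightarrow> complex" where
  "zseries s = (\<Sum>n. of_nat (Suc n) powr (- s))"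

lemma ffac_Suc: "ffac (Suc i) a = ffac i a * (a - of_nat i)"
  by (simp add: ffac_def)

lemma summable_Suc_powr: "p > 1 \<Longrightarrow> summable (\<lambda>n. real (Suc n) powr (- p))"
  using summable_Suc_iff[of "\<lambda>n. real n powr (- p)"] summable_real_powr_iff[of "- p"] by simp

lemma zseries_sums:
  assumes "Re s > 1"
  shows   "(\<lambda>n. of_nat (Suc n) powr (- s)) sums zseries s"
proof -
  have eq: "norm ((of_nat (Suc n) :: complex) powr (- s)) = real (Suc n) powr (- Re s)" for n
    using norm_powr_real_powr[of "of_nat (Suc n)" "- s"] by simp
  have "summable (\<lambda>n. norm ((of_nat (Suc n) :: complex) powr (- s)))"
    unfolding eq using summable_Suc_powr[OF assms] by simp
  then show ?thesis
    unfolding zseries_def by (rule summable_sums[OF summable_norm_cancel])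
qed

lemma norm_zrem_le:
  assumes "Re s \<ge> - real K"
  shows   "norm (zrem K m s) \<le> norm (ffac (Suc K) (1 - s)) * real (Suc m) powr (- Re s - real K)"
proof -
  define S where "S = closed_segment (of_nat (Suc m)) (of_nat (Suc (Suc m)) :: complex)"
  define f where "f = (\<lambda>i x. ffac i (1 - s) * x powr (1 - s - of_nat i))"
  define B where "B = norm (ffac (Suc K) (1 - s)) * real (Suc m) powr (- Re s - real K)"
  have S: "\<exists>r. x = of_real r \<and> r \<ge> real (Suc m)" if "x \<in> S" for x
  proof -
    have "\<exists>u. 0 \<le> u \<and> u \<le> 1 \<and> x = (1 - u) *\<^sub>R of_nat (Suc m) + u *\<^sub>R of_nat (Suc (Suc m))"
      using that unfolding S_def in_segment .
    then obtain u where u: "0 \<le> u" "u \<le> 1"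
      "x = (1 - u) *\<^sub>R of_nat (Suc m) + u *\<^sub>R of_nat (Suc (Suc m))"
      by (elim exE conjE) (rule that)
    have "x = of_real (real (Suc m) + u)"
      using u(3) by (simp add: scaleR_conv_of_real algebra_simps)
    then show ?thesis using u(1) by (intro exI[of _ "real (Suc m) + u"] conjI) simp_all
  qed
  have "norm (f 0 (of_nat (Suc (Suc m))) -
          (\<Sum>i\<le>K. f i (of_nat (Suc m)) * (of_nat (Suc (Suc m)) - of_nat (Suc m)) ^ i / fact i))
        \<le> B * norm (of_nat (Suc (Suc m)) - of_nat (Suc m) :: complex) ^ Suc K / fact K"
  proof (rule complex_Taylor)
    show "convex S" by (simp add: S_def)
    show "of_nat (Suc m) \<in> S" "of_nat (Suc (Suc m)) \<in> S"
      unfolding S_def by (rule ends_in_segment)+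
  next
    fix i x assume "x \<in> S"
    then obtain r where r: "x = of_real r" "r \<ge> real (Suc m)" using S by blast
    then have "x \<notin> \<real>\<^sub>\<le>\<^sub>0" by (simp add: complex_nonpos_Reals_iff)
    then have "((\<lambda>x. x powr (1 - s - of_nat i)) has_field_derivative
                 (1 - s - of_nat i) * x powr (1 - s - of_nat i - 1)) (at x within S)"
      by (rule has_field_derivative_at_within[OF has_field_derivative_powr])
    then have "((\<lambda>x. ffac i (1 - s) * x powr (1 - s - of_nat i)) has_field_derivative
                 ffac i (1 - s) * ((1 - s - of_nat i) * x powr (1 - s - of_nat i - 1))) (at x within S)"
      by (rule DERIV_cmult)
    moreover have "1 - s - of_nat (Suc i) = 1 - s - of_nat i - 1" by simp
    ultimately show "(f i has_field_derivative f (Suc i) x) (at x within S)"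
      unfolding f_def ffac_Suc by (simp only: mult.assoc)
  next
    fix x assume "x \<in> S"
    then obtain r where r: "x = of_real r" "r \<ge> real (Suc m)" using S by blast
    have "norm (x powr (1 - s - of_nat (Suc K))) = r powr (- Re s - real K)"
      using r norm_powr_real_powr[of x "1 - s - of_nat (Suc K)"] by simp
    also have "\<dots> \<le> real (Suc m) powr (- Re s - real K)"
      using r assms by (intro powr_mono2') auto
    finally show "norm (f (Suc K) x) \<le> B"
      unfolding f_def B_def norm_mult by (intro mult_left_mono) auto
  qed
  also have "\<dots> = B / fact K" by simp
  also have "\<dots> \<le> B"
    using divide_left_mono[of 1 "fact K" B] fact_ge_1[of K, where 'a = real] by (simp add: B_def)
  finally show ?thesis
    by (simp add: f_def B_def zrem_def ffac_def)
qed

lemma holomorphic_ffac [holomorphic_intros]: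
  "f holomorphic_on A \<Longrightarrow> (\<lambda>s. ffac i (f s)) holomorphic_on A"
  unfolding ffac_def by (intro holomorphic_intros)

lemma zrem_series:
  assumes K: "K > 0"
  shows "(\<lambda>s. \<Sum>m. zrem K m s) holomorphic_on {s. Re s > 1 - real K}"
proof (rule holomorphic_uniform_sequence)
  show "open {s. Re s > 1 - real K}" by (rule open_halfspace_Re_gt)
  show "(\<lambda>s. \<Sum>m<n. zrem K m s) holomorphic_on {s. Re s > 1 - real K}" for n
    unfolding zrem_def by (intro holomorphic_intros) auto
next
  fix x assume x: "x \<in> {s. Re s > 1 - real K}"
  define d where "d = (Re x - (1 - real K)) / 2"
  have d: "d > 0" using x by (simp add: d_def)
  have Re: "Re s \<ge> Re x - d" if "s \<in> cball x d" for s
    using that abs_Re_le_cmod[of "x - s"] by (auto simp: dist_norm)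
  have xd: "Re x - d > 1 - real K" using x by (simp add: d_def field_simps)
  have "compact ((\<lambda>s. ffac (Suc K) (1 - s)) ` cball x d)"
    by (intro compact_continuous_image holomorphic_on_imp_continuous_on holomorphic_intros) auto
  then obtain C where C: "\<And>s. s \<in> cball x d \<Longrightarrow> norm (ffac (Suc K) (1 - s)) \<le> C" 
    by (meson bounded_iff compact_imp_bounded imageI)
  have "uniform_limit (cball x d) (\<lambda>n s. \<Sum>m<n. zrem K m s) (\<lambda>s. \<Sum>m. zrem K m s) sequentially"
  proof (rule Weierstrass_m_test)
    fix m s assume s: "s \<in> cball x d"
    have "norm (zrem K m s) \<le> norm (ffac (Suc K) (1 - s)) * real (Suc m) powr (- Re s - real K)"
      using Re[OF s] xd by (intro norm_zrem_le) auto
    also have "\<dots> \<le> C * real (Suc m) powr (- (Re x - d + real K))"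
      using Re[OF s] C[OF s] norm_ge_zero[of "ffac (Suc K) (1 - s)"]
      by (intro mult_mono powr_mono) (auto simp del: norm_ge_zero)
    finally show "norm (zrem K m s) \<le> C * real (Suc m) powr (- (Re x - d + real K))" .
  next
    show "summable (\<lambda>m. C * real (Suc m) powr (- (Re x - d + real K)))"
      using xd by (intro summable_mult summable_Suc_powr) auto
  qed
  then show "\<exists>d>0. cball x d \<subseteq> {s. 1 - real K < Re s} \<and>
      uniform_limit (cball x d) (\<lambda>n s. \<Sum>m<n. zrem K m s) (\<lambda>s. \<Sum>m. zrem K m s) sequentially"
    using d Re xd by (intro exI[of _ d]) force
qed

lemma zrem_sums:
  assumes s: "Re s > 1"
  shows "(\<lambda>m. zrem (Suc N) m s) sums
           ((s - 1) * zseries s - 1 +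
            (\<Sum>i<N. ffac (Suc i) (1 - s) / fact (i + 2) * ((s + of_nat i) * zseries (s + of_nat (Suc i)))))"
proof -
  have lim: "(\<lambda>m. (of_nat (Suc m) :: complex) powr (1 - s)) \<longlonglongrightarrow> 0"
  proof (rule tendsto_norm_zero_cancel)
    have "norm ((of_nat (Suc m) :: complex) powr (1 - s)) = real (Suc m) powr (- (Re s - 1))" for m
      using norm_powr_real_powr[of "of_nat (Suc m)" "1 - s"] by simp
    moreover have "(\<lambda>m. real (Suc m) powr (- (Re s - 1))) \<longlonglongrightarrow> 0"
      using s by (intro tendsto_neg_powr filterlim_compose[OF filterlim_real_sequentially] filterlim_Suc) auto
    ultimately show "(\<lambda>m. norm ((of_nat (Suc m) :: complex) powr (1 - s))) \<longlonglongrightarrow> 0" by simp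
  qed
  have tele: "(\<lambda>m. of_nat (Suc (Suc m)) powr (1 - s) - of_nat (Suc m) powr (1 - s)) sums (0 - 1 :: complex)"
    using telescope_sums[OF lim] by simp
  define t where "t = (\<lambda>m i. ffac (Suc i) (1 - s) / fact (Suc i) * of_nat (Suc m) powr (- (s + of_nat i)))"
  have t: "(\<lambda>m. \<Sum>i<Suc N. t m i) sums
          (\<Sum>i<Suc N. ffac (Suc i) (1 - s) / fact (Suc i) * zseries (s + of_nat i))"
    unfolding t_def using s by (intro sums_sum sums_mult zseries_sums) auto
  have eq: "zrem (Suc N) m s =
      of_nat (Suc (Suc m)) powr (1 - s) - of_nat (Suc m) powr (1 - s) - (\<Sum>i<Suc N. t m i)" for m
  proof -
    have "(\<Sum>i\<le>Suc N. ffac i (1 - s) * of_nat (Suc m) powr (1 - s - of_nat i) / fact i) =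
          of_nat (Suc m) powr (1 - s) +
          (\<Sum>i\<le>N. ffac (Suc i) (1 - s) * of_nat (Suc m) powr (1 - s - of_nat (Suc i)) / fact (Suc i))"
      by (subst sum.atMost_Suc_shift) (simp add: ffac_def)
    also have "(\<Sum>i\<le>N. ffac (Suc i) (1 - s) * of_nat (Suc m) powr (1 - s - of_nat (Suc i)) / fact (Suc i))
             = (\<Sum>i<Suc N. t m i)"
      unfolding t_def lessThan_Suc_atMost by (intro sum.cong) (simp_all add: algebra_simps)
    finally show ?thesis unfolding zrem_def by (simp add: algebra_simps)
  qed
  have "(\<lambda>m. zrem (Suc N) m s) sums
          (0 - 1 - (\<Sum>i<Suc N. ffac (Suc i) (1 - s) / fact (Suc i) * zseries (s + of_nat i)))"
    unfolding eq by (intro sums_diff[OF tele t])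
  also have "(\<Sum>i<Suc N. ffac (Suc i) (1 - s) / fact (Suc i) * zseries (s + of_nat i)) =
      (1 - s) * zseries s +
      (\<Sum>i<N. ffac (Suc (Suc i)) (1 - s) / fact (Suc (Suc i)) * zseries (s + of_nat (Suc i)))"
    by (subst sum.lessThan_Suc_shift) (simp add: ffac_def)
  also have "(\<Sum>i<N. ffac (Suc (Suc i)) (1 - s) / fact (Suc (Suc i)) * zseries (s + of_nat (Suc i))) =
      - (\<Sum>i<N. ffac (Suc i) (1 - s) / fact (i + 2) * ((s + of_nat i) * zseries (s + of_nat (Suc i))))"
    unfolding sum_negf[symmetric]
  proof (rule sum.cong)
    fix i
    have "ffac (Suc (Suc i)) (1 - s) = - (ffac (Suc i) (1 - s) * (s + of_nat i))"
      by (subst ffac_Suc) (simp add: algebra_simps)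
    then show "ffac (Suc (Suc i)) (1 - s) / fact (Suc (Suc i)) * zseries (s + of_nat (Suc i)) =
          - (ffac (Suc i) (1 - s) / fact (i + 2) * ((s + of_nat i) * zseries (s + of_nat (Suc i))))"
      by simp
  qed simp
  finally show ?thesis by (simp add: algebra_simps)
qed

lemma zeta_continuation_step:
  assumes hol: "N > 0 \<Longrightarrow> g holomorphic_on {s. Re s > 1 - real N}"
      and g: "\<And>s. Re s > 1 \<Longrightarrow> g s = (s - 1) * zseries s"
  shows "\<exists>h. h holomorphic_on {s. Re s > 1 - real (Suc N)} \<and>
             (\<forall>s. Re s > 1 \<longrightarrow> h s = (s - 1) * zseries s)"
proof -
  define h where "h = (\<lambda>s. (\<Sum>m. zrem (Suc N) m s) + 1 -
    (\<Sum>i<N. ffac (Suc i) (1 - s) / fact (i + 2) * g (s + of_nat (Suc i))))"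
  have "h s = (s - 1) * zseries s" if "Re s > 1" for s
  proof -
    have "g (s + of_nat (Suc i)) = (s + of_nat i) * zseries (s + of_nat (Suc i))" for i
      using that by (subst g) auto
    then show ?thesis
      unfolding h_def sums_unique[OF zrem_sums[OF that, of N], symmetric] by simp
  qed
  moreover have "(\<lambda>s. g (s + of_nat (Suc i))) holomorphic_on {s. Re s > 1 - real (Suc N)}"
    if "i < N" for i
    using that
    by (intro holomorphic_on_compose_gen[unfolded o_def, OF _ hol] holomorphic_intros) auto
  then have "h holomorphic_on {s. Re s > 1 - real (Suc N)}"
    unfolding h_def by (intro holomorphic_intros zrem_series) auto
  ultimately show ?thesis by blast
qed

lemma zeta_continuation_halfplane:
  "\<exists>h. h holomorphic_on {s. Re s > 1 - real (Suc N)} \<and>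
       (\<forall>s. Re s > 1 \<longrightarrow> h s = (s - 1) * zseries s)"
proof (induction N)
  case 0
  show ?case using zeta_continuation_step[of 0 "\<lambda>s. (s - 1) * zseries s"] by auto
next
  case (Suc N)
  then obtain g where "g holomorphic_on {s. Re s > 1 - real (Suc N)}"
    "\<And>s. Re s > 1 \<Longrightarrow> g s = (s - 1) * zseries s" by blast
  then show ?case by (intro zeta_continuation_step)
qed

lemma is_zeta_continuation_exists: "\<exists>f. is_zeta_continuation f"
proof -
  obtain h where h: "\<And>N. h N holomorphic_on {s. Re s > 1 - real (Suc N)}"
    "\<And>N s. Re s > 1 \<Longrightarrow> h N s = (s - 1) * zseries s"
    using zeta_continuation_halfplane by metis
  have agree: "h M s = h N s" if "M \<le> N" "Re s > 1 - real (Suc M)" for M N s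
  proof (rule analytic_continuation_open[where s = "{s. Re s > 1}" and s' = "{s. Re s > 1 - real (Suc M)}"
           and f = "h M" and g = "h N" and z = s])
    show "open {s. Re s > 1}" "open {s. Re s > 1 - real (Suc M)}" by (rule open_halfspace_Re_gt)+
    show "{s. Re s > 1} \<noteq> {}" by (auto intro!: exI[of _ 2])
    show "connected {s. Re s > 1 - real (Suc M)}"
      by (intro convex_connected convex_halfspace_Re_gt)
    show "h N holomorphic_on {s. Re s > 1 - real (Suc M)}"
      using that(1) by (intro holomorphic_on_subset[OF h(1)[of N]]) auto
  qed (use that h in auto)
  define g where "g = (\<lambda>s. h (nat \<lceil>\<bar>Re s\<bar>\<rceil> + 1) s)"
  have idx: "Re s > 1 - real (Suc (nat \<lceil>\<bar>Re s\<bar>\<rceil> + 1))" for s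
    by linarith
  have g_eq: "g s = h N s" if "Re s > 1 - real (Suc N)" for s N
  proof (cases "N \<le> nat \<lceil>\<bar>Re s\<bar>\<rceil> + 1")
    case True
    show ?thesis unfolding g_def by (rule agree[OF True that, symmetric])
  next
    case False
    show ?thesis unfolding g_def by (rule agree[OF _ idx]) (use False in simp)
  qed
  have "g holomorphic_on {s. Re s > 1 - real (Suc N)}" for N
    by (rule holomorphic_transform[OF h(1)[of N]]) (use g_eq in auto)
  then have "g holomorphic_on (\<Union>N. {s. Re s > 1 - real (Suc N)})"
    by (intro holomorphic_on_UN_open open_halfspace_Re_gt) auto
  moreover have "(\<Union>N. {s. Re s > 1 - real (Suc N)}) = UNIV"
    using idx by blast
  ultimately have g_hol: "g holomorphic_on UNIV" by simp
  have g1: "g s = (s - 1) * zseries s" if "Re s > 1" for s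
    using g_eq[of 0 s] h(2)[of s 0] that by simp
  define f where "f = (\<lambda>s. g s / (s - 1))"
  have "f holomorphic_on (- {1})"
    unfolding f_def by (intro holomorphic_intros holomorphic_on_subset[OF g_hol]) auto
  moreover have "(\<lambda>n. of_nat (Suc n) powr (- s)) sums f s" if "Re s > 1" for s
  proof -
    have "f s = zseries s" using that by (auto simp: f_def g1)
    then show ?thesis using zseries_sums[OF that] by simp
  qed
  moreover have "f 1 = 0" by (simp add: f_def)
  ultimately show ?thesis unfolding is_zeta_continuation_def by blast
qed

theorem is_zeta_continuation_zeta: "is_zeta_continuation zeta"
  unfolding zeta_def
  by (rule theI'[of is_zeta_continuation])
     (use is_zeta_continuation_exists is_zeta_continuation_unique in blast)

definition Lindelof_Hypothesis :: bool where
  "Lindelof_Hypothesis \<longleftrightarrow>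
     (\<forall>\<epsilon>>0. (\<lambda>t::real. norm (zeta (Complex (1/2) t))) \<in> O[at_infinity](\<lambda>t. \<bar>t\<bar> powr \<epsilon>))"


section \<open>The generalized Boole transformations and their invariant measures\<close>

definition boole_map :: "real \<Rightarrow> real \<Rightarrow> real \<Rightarrow> real" where
  "boole_map \<alpha> \<beta> x =
     (if x = \<beta> then \<beta> else \<alpha> / 2 * ((x + \<beta>) / \<alpha> - \<alpha> / (x - \<beta>)))"

definition boole_measure :: "real \<Rightarrow> real \<Rightarrow> real measure" where
  "boole_measure \<alpha> \<beta> = density lborel (\<lambda>t. ennreal (\<alpha> / pi * (1 / (\<alpha>\<^sup>2 + (t - \<beta>)\<^sup>2))))"


section \<open>Stoltz sequences\<close>

definition stoltz_upper :: "(int \<times> nat) set \<Rightarrow> real \<Rightarrow> (int \<times> nat) set" where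
  "stoltz_upper Z h = {(n, k) \<in> Z. real k \<ge> h}"

definition stoltz_cone :: "(int \<times> nat) set \<Rightarrow> real \<Rightarrow> real \<Rightarrow> (int \<times> int) set" where
  "stoltz_cone Z h a =
     {(z, s). \<exists>(y, r) \<in> stoltz_upper Z h. real_of_int \<bar>z - y\<bar> < a * real_of_int (s - int r)}"

definition stoltz_section :: "(int \<times> nat) set \<Rightarrow> real \<Rightarrow> real \<Rightarrow> nat \<Rightarrow> int set" where
  "stoltz_section Z h a m = {n. (n, int m) \<in> stoltz_cone Z h a}"

text \<open>
  Sequences are indexed from 1; the values at index 0 play no role.  Finiteness of the sections
  is stated separately because \<open>card\<close> is 0 on infinite sets.
\<close>

definition stoltz :: "(nat \<Rightarrow> nat) \<Rightarrow> (nat \<Rightarrow> nat) \<Rightarrow> bool" where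
  "stoltz n k \<longleftrightarrow>
     (\<exists>(Z :: (int \<times> nat) set) (h :: nat \<Rightarrow> real).
        filterlim h at_top sequentially \<and>
        (\<forall>t\<ge>1. \<forall>l\<ge>t. (int (n l), k l) \<in> stoltz_upper Z (h t)) \<and>
        (\<exists>h\<^sub>0 a\<^sub>0 A. a\<^sub>0 > 0 \<and> A > 0 \<and>
           (\<forall>m>0. finite (stoltz_section Z h\<^sub>0 a\<^sub>0 m) \<and>
                  real (card (stoltz_section Z h\<^sub>0 a\<^sub>0 m)) \<le> A * real m)))"

end

theory Submission
  imports Defs "HOL-Real_Asymp.Real_Asymp"
begin

text \<open>
  If all moments of \<open>zeta\<^sup>(\<^sup>k\<^sup>)\<close> on the critical line against the Cauchy density are finite, then
  \<open>zeta\<^sup>(\<^sup>k\<^sup>)\<close> is \<open>O(|t|\<^sup>\<epsilon>)\<close> there: its derivative grows only polynomially, so a large value persists on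
  an interval of polynomially small length, which is incompatible with a high moment.  The three
  lines theorem moves such a bound to the strip between the critical line and \<open>Re s = 2\<close>, where
  horizontal integration lowers the order of the derivative; conversely, Cauchy's inequality on
  small circles around the critical line raises it.

  The map \<open>w \<mapsto> \<beta> - \<alpha> cot (\<pi> w)\<close> conjugates angle doubling on the unit interval with Lebesgue measure
  to the Boole map.  Under the Lindelof Hypothesis the observable grows like an arbitrarily small
  power at the end points, and no maximal inequality is needed.  It is dominated, outside a set of
  measure \<open>O(k\<^sup>-\<^sup>4)\<close>, along \<open>k\<close> steps of an orbit by a function of about \<open>5 log\<^sub>2 k\<close> binary digits,
  whose Birkhoff sums split into sums of independent variables, so that Chernoff's bound applies.
  The Stoltz condition allows at most \<open>A (k + 1)\<close> starting points \<open>n\<close> for a given \<open>k\<close>, and the measures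
  of all exceptional sets are summable: the Borel-Cantelli lemma gives almost everywhere convergence.
\<close>

section \<open>Growth of the zeta function in vertical strips\<close>

text \<open>A window of indices \<open>n + 1\<close>, ..., \<open>n + k\<close> may start far beyond
  its own length, so convergence of ordinary Birkhoff averages does not give that of the moving
  ones; a tail bound for each single window replaces it. Since \<open>k\<close> may take a value
  many times along the sequence, exceptional sets are counted by pairs of \<open>n\<close> and
  \<open>k\<close>, with \<open>n\<close> in a finite set attached to \<open>k\<close>, and not by
  the index \<open>q\<close>. The constants share one budget. With \<open>m\<close> digits and
  \<open>2 ^ m\<close> about \<open>k ^ 5\<close>, an orbit of \<open>k\<close> steps meets the two
  end cells with probability at most \<open>2 k / 2 ^ m\<close>, about \<open>2 / k ^ 4\<close>;
  multiplied by the \<open>O(k)\<close> starting points this is summable. A singularity of order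
  \<open>e\<close> at the end points leaves a bound of order \<open>2 ^ (m e)\<close> on the other
  cells, and \<open>e = 1/40\<close> makes its square about \<open>k ^ (1/4)\<close>, so that the
  Chernoff exponent is of order \<open>k ^ (3/4) / log k\<close>. For the \<open>l\<close>-th moment
  the Lindelof Hypothesis is used with exponent \<open>1 / (40 l)\<close>.\<close>

lemma zeta_holomorphic: "zeta holomorphic_on - {1}"
  using is_zeta_continuation_zeta by (simp add: is_zeta_continuation_def)

lemma zeta_eq_zseries: "Re s > 1 \<Longrightarrow> zeta s = zseries s"
  using is_zeta_continuation_zeta zseries_sums sums_unique2 unfolding is_zeta_continuation_def by blast

text \<open>The Taylor remainders of order 1 sum to a holomorphic function on
  \<open>Re s > 0\<close>, and this half plane stays connected without the pole, so the identity
  continues from \<open>Re s > 1\<close>. The growth estimate left of 1 starts from this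
  series.\<close>

lemma zeta_eq_zrem:
  assumes "Re s > 0" "s \<noteq> 1"
  shows "(s - 1) * zeta s = (\<Sum>m. zrem 1 m s) + 1"
proof (rule analytic_continuation_open[where s = "{s. Re s > 1}" and s' = "{s. Re s > 0} - {1}"
      and f = "\<lambda>s. (s - 1) * zeta s" and g = "\<lambda>s. (\<Sum>m. zrem 1 m s) + 1"])
  show "open {s. Re s > 1}" by (rule open_halfspace_Re_gt)
  show "open ({s. Re s > 0} - {1})" by (intro open_Diff open_halfspace_Re_gt) auto
  show "{s. Re s > 1} \<noteq> {}" by (auto intro!: exI[of _ 2])
  show "connected ({s. Re s > 0} - {1 :: complex})"
    by (intro connected_open_delete open_halfspace_Re_gt convex_connected convex_halfspace_Re_gt) auto
  show "(\<lambda>s. (s - 1) * zeta s) holomorphic_on {s. Re s > 0} - {1}"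
    by (intro holomorphic_intros holomorphic_on_subset[OF zeta_holomorphic]) auto
  have "(\<lambda>s. \<Sum>m. zrem 1 m s) holomorphic_on {s. Re s > 0} - {1}"
    by (rule holomorphic_on_subset[OF zrem_series[of 1]]) auto
  then show "(\<lambda>s. (\<Sum>m. zrem 1 m s) + 1) holomorphic_on {s. Re s > 0} - {1}"
    by (intro holomorphic_intros)
  fix z assume z: "z \<in> {s. Re s > 1}"
  then show "(z - 1) * zeta z = (\<Sum>m. zrem 1 m z) + 1"
    using sums_unique[OF zrem_sums[of z 0]] by (simp add: zeta_eq_zseries diff_eq_eq)
qed (use assms in auto)

text \<open>The threshold \<open>T\<close> keeps the pole out of the estimate. The case
  \<open>a = b\<close> is allowed and describes a single vertical line, so the critical line needs
  no predicate of its own.\<close>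

definition strip_bound :: "(complex \<Rightarrow> complex) \<Rightarrow> real \<Rightarrow> real \<Rightarrow> real \<Rightarrow> bool" where
  "strip_bound f a b A \<longleftrightarrow>
     (\<exists>C T. \<forall>s. a \<le> Re s \<and> Re s \<le> b \<and> T \<le> \<bar>Im s\<bar> \<longrightarrow> norm (f s) \<le> C * (1 + \<bar>Im s\<bar>) powr A)"

lemma strip_boundI:
  "(\<And>s. a \<le> Re s \<Longrightarrow> Re s \<le> b \<Longrightarrow> T \<le> \<bar>Im s\<bar> \<Longrightarrow> norm (f s) \<le> C * (1 + \<bar>Im s\<bar>) powr A)
   \<Longrightarrow> strip_bound f a b A"
  unfolding strip_bound_def by blast

text \<open>Positive \<open>C\<close> serves monotonicity arguments, and \<open>T \<ge> 2\<close>
  keeps the pole out of reach even after a move by a distance 1.\<close>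

lemma strip_boundE:
  assumes "strip_bound f a b A"
  obtains C T where "C > 0" "T \<ge> 2" 
    "\<And>s. a \<le> Re s \<Longrightarrow> Re s \<le> b \<Longrightarrow> T \<le> \<bar>Im s\<bar> \<Longrightarrow> norm (f s) \<le> C * (1 + \<bar>Im s\<bar>) powr A"
proof -
  obtain C T where *: "\<And>s. a \<le> Re s \<Longrightarrow> Re s \<le> b \<Longrightarrow> T \<le> \<bar>Im s\<bar> \<Longrightarrow> norm (f s) \<le> C * (1 + \<bar>Im s\<bar>) powr A"
    using assms unfolding strip_bound_def by blast
  show thesis
  proof (rule that[of "max C 1" "max T 2"])
    fix s assume s: "a \<le> Re s" "Re s \<le> b" "max T 2 \<le> \<bar>Im s\<bar>"
    have "C * (1 + \<bar>Im s\<bar>) powr A \<le> max C 1 * (1 + \<bar>Im s\<bar>) powr A"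
      by (intro mult_right_mono) auto
    moreover have "norm (f s) \<le> C * (1 + \<bar>Im s\<bar>) powr A" using s by (intro *) auto
    ultimately show "norm (f s) \<le> max C 1 * (1 + \<bar>Im s\<bar>) powr A" by linarith
  qed auto
qed

lemma strip_bound_mono:
  assumes "strip_bound f a b A" "a \<le> a'" "b' \<le> b" "A \<le> A'"
  shows "strip_bound f a' b' A'"
proof -
  obtain C T where C: "C > 0" "T \<ge> 2" 
    "\<And>s. a \<le> Re s \<Longrightarrow> Re s \<le> b \<Longrightarrow> T \<le> \<bar>Im s\<bar> \<Longrightarrow> norm (f s) \<le> C * (1 + \<bar>Im s\<bar>) powr A"
    by (rule strip_boundE[OF assms(1)], rule that)
  show ?thesis
  proof (rule strip_boundI[of _ _ T _ C])
    fix s assume s: "a' \<le> Re s" "Re s \<le> b'" "T \<le> \<bar>Im s\<bar>"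
    have "norm (f s) \<le> C * (1 + \<bar>Im s\<bar>) powr A" using C(3)[of s] s assms by simp
    also have "\<dots> \<le> C * (1 + \<bar>Im s\<bar>) powr A'"
      using C(1) assms(4) by (intro mult_left_mono powr_mono) auto
    finally show "norm (f s) \<le> C * (1 + \<bar>Im s\<bar>) powr A'" .
  qed
qed

lemma strip_bound_split:
  assumes "strip_bound f a b A" "strip_bound f b c A"
  shows "strip_bound f a c A"
proof -
  obtain C T where C: "C > 0" "T \<ge> 2" 
    "\<And>s. a \<le> Re s \<Longrightarrow> Re s \<le> b \<Longrightarrow> T \<le> \<bar>Im s\<bar> \<Longrightarrow> norm (f s) \<le> C * (1 + \<bar>Im s\<bar>) powr A"
    by (rule strip_boundE[OF assms(1)], rule that)
  obtain C' T' where C': "C' > 0" "T' \<ge> 2" 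
    "\<And>s. b \<le> Re s \<Longrightarrow> Re s \<le> c \<Longrightarrow> T' \<le> \<bar>Im s\<bar> \<Longrightarrow> norm (f s) \<le> C' * (1 + \<bar>Im s\<bar>) powr A"
    by (rule strip_boundE[OF assms(2)], rule that)
  show ?thesis
  proof (rule strip_boundI[of _ _ "max T T'" _ "max C C'"])
    fix s assume s: "a \<le> Re s" "Re s \<le> c" "max T T' \<le> \<bar>Im s\<bar>"
    have "norm (f s) \<le> C * (1 + \<bar>Im s\<bar>) powr A \<or> norm (f s) \<le> C' * (1 + \<bar>Im s\<bar>) powr A"
      using C(3)[of s] C'(3)[of s] s by linarith
    moreover have "C * (1 + \<bar>Im s\<bar>) powr A \<le> max C C' * (1 + \<bar>Im s\<bar>) powr A"
      "C' * (1 + \<bar>Im s\<bar>) powr A \<le> max C C' * (1 + \<bar>Im s\<bar>) powr A" by (intro mult_right_mono; simp)+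
    ultimately show "norm (f s) \<le> max C C' * (1 + \<bar>Im s\<bar>) powr A" by linarith
  qed
qed

text \<open>The remainder with index \<open>m\<close> is at most \<open>F\<close> times
  \<open>(m + 1) powr (-5/4)\<close>, where \<open>F\<close> is the norm of
  \<open>(1 - s) s\<close>. Division by \<open>s - 1\<close> leaves one factor \<open>s\<close>,
  hence the exponent 1. The abscissa 1/4 provides room to the left of the critical line, which the
  later circles and interpolations use.\<close>

lemma strip_bound_zeta: "strip_bound zeta (1/4) 3 1"
proof -
  define S where "S = (\<Sum>m. real (Suc m) powr (- (5/4)))"
  have sm: "summable (\<lambda>m. real (Suc m) powr (- (5/4)))" by (rule summable_Suc_powr) simp
  have S0: "S \<ge> 0" unfolding S_def by (intro suminf_nonneg sm) auto
  show ?thesis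
  proof (rule strip_boundI[of _ _ 1 _ "1 + 4 * S"])
    fix s assume s: "1/4 \<le> Re s" "Re s \<le> 3" "1 \<le> \<bar>Im s\<bar>"
    define F where "F = norm (1 - s) * norm s"
    have b: "norm (zrem 1 m s) \<le> F * real (Suc m) powr (- (5/4))" for m
    proof -
      have "norm (zrem 1 m s) \<le> norm (ffac (Suc 1) (1 - s)) * real (Suc m) powr (- Re s - real 1)"
        by (rule norm_zrem_le) (use s in simp)
      also have "ffac (Suc 1) (1 - s) = (1 - s) * (- s)"
        by (simp add: ffac_def algebra_simps)
      also have "norm \<dots> = F" by (simp add: F_def norm_mult)
      also have "F * real (Suc m) powr (- Re s - real 1) \<le> F * real (Suc m) powr (- (5/4))"
        using s by (intro mult_left_mono powr_mono) (auto simp: F_def)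
      finally show ?thesis .
    qed
    have sm': "summable (\<lambda>m. norm (zrem 1 m s))"
      by (rule summable_comparison_test'[OF summable_mult[OF sm, of F], of 0]) (use b in auto)
    have "norm (\<Sum>m. zrem 1 m s) \<le> (\<Sum>m. norm (zrem 1 m s))"
      by (rule summable_norm[OF sm'])
    also have "\<dots> \<le> (\<Sum>m. F * real (Suc m) powr (- (5/4)))"
      by (rule suminf_le[OF b sm' summable_mult[OF sm]])
    also have "\<dots> = F * S" unfolding S_def by (rule suminf_mult[OF sm])
    finally have n: "norm (\<Sum>m. zrem 1 m s) \<le> F * S" .
    have s1: "norm (s - 1) \<ge> 1" using abs_Im_le_cmod[of "s - 1"] s by simp
    then have s_ne: "s \<noteq> 1" by auto
    then have "norm (s - 1) * norm (zeta s) = norm ((\<Sum>m. zrem 1 m s) + 1)"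
      using zeta_eq_zrem[of s] s by (subst norm_mult[symmetric]) simp
    also have "\<dots> \<le> F * S + 1" using n norm_triangle_ineq[of "\<Sum>m. zrem 1 m s" 1] by simp
    also have "\<dots> \<le> norm (s - 1) * (norm s * S + 1)"
      using s1 by (simp add: F_def norm_minus_commute[of 1] algebra_simps)
    finally have "norm (zeta s) \<le> norm s * S + 1" using s_ne by (simp add: mult_le_cancel_left)
    also have "norm s \<le> 4 * (1 + \<bar>Im s\<bar>)" using cmod_le[of s] s by simp
    then have "norm s * S \<le> 4 * (1 + \<bar>Im s\<bar>) * S" using S0 by (rule mult_right_mono)
    finally show "norm (zeta s) \<le> (1 + 4 * S) * (1 + \<bar>Im s\<bar>) powr 1"
      by (simp add: algebra_simps)
  qed
qed

lemma strip_bound_zeta_right: "strip_bound zeta (3/2) 3 0"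
proof -
  have sm: "summable (\<lambda>m. real (Suc m) powr (- (3/2)))" by (rule summable_Suc_powr) simp
  show ?thesis
  proof (rule strip_boundI[of _ _ 1 _ "\<Sum>m. real (Suc m) powr (- (3/2))"])
    fix s assume s: "3/2 \<le> Re s" "Re s \<le> 3" "1 \<le> \<bar>Im s\<bar>"
    have b: "norm ((of_nat (Suc m) :: complex) powr (- s)) \<le> real (Suc m) powr (- (3/2))" for m
    proof -
      have "norm ((of_nat (Suc m) :: complex) powr (- s)) = real (Suc m) powr (- Re s)"
        using norm_powr_real_powr[of "of_nat (Suc m)" "- s"] by simp
      also have "\<dots> \<le> real (Suc m) powr (- (3/2))" using s by (intro powr_mono) auto
      finally show ?thesis .
    qed
    have sm': "summable (\<lambda>m. norm ((of_nat (Suc m) :: complex) powr (- s)))"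
      by (rule summable_comparison_test'[OF sm, of 0]) (use b in \<open>auto simp del: of_nat_Suc\<close>)
    have "zeta s = (\<Sum>m. (of_nat (Suc m) :: complex) powr (- s))"
      using zeta_eq_zseries[of s] s by (simp add: zseries_def)
    also have "norm \<dots> \<le> (\<Sum>m. norm ((of_nat (Suc m) :: complex) powr (- s)))"
      by (rule summable_norm[OF sm'])
    also have "\<dots> \<le> (\<Sum>m. real (Suc m) powr (- (3/2)))"
      by (rule suminf_le[OF b sm' sm])
    finally show "norm (zeta s) \<le> (\<Sum>m. real (Suc m) powr (- (3/2))) * (1 + \<bar>Im s\<bar>) powr 0" by simp
  qed
qed

text \<open>Cauchy's inequality on circles of radius \<open>r\<close>: the strip shrinks by
  \<open>r\<close> on each side, and the exponent survives because
  \<open>1 + |Im x| \<le> 2 (1 + |Im s|)\<close> on the circle.\<close>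

lemma strip_bound_deriv:
  assumes hol: "f holomorphic_on - {1}" and f: "strip_bound f a b A" and A: "A \<ge> 0"
    and r: "0 < r" "r \<le> 1"
  shows "strip_bound ((deriv ^^ k) f) (a + r) (b - r) A"
proof -
  obtain C T where C: "C > 0" "T \<ge> 2" 
    "\<And>s. a \<le> Re s \<Longrightarrow> Re s \<le> b \<Longrightarrow> T \<le> \<bar>Im s\<bar> \<Longrightarrow> norm (f s) \<le> C * (1 + \<bar>Im s\<bar>) powr A"
    by (rule strip_boundE[OF f], rule that)
  show ?thesis
  proof (rule strip_boundI[of _ _ "T + 1" _ "fact k * (C * 2 powr A) / r ^ k"])
    fix s assume s: "a + r \<le> Re s" "Re s \<le> b - r" "T + 1 \<le> \<bar>Im s\<bar>"
    have no1: "1 \<notin> cball s r"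
    proof
      assume "1 \<in> cball s r"
      then have "norm (s - 1) \<le> r" by (simp add: dist_norm)
      then show False using abs_Im_le_cmod[of "s - 1"] s C(2) r by simp
    qed
    have "norm ((deriv ^^ k) f s) \<le> fact k * (C * 2 powr A * (1 + \<bar>Im s\<bar>) powr A) / r ^ k"
    proof (rule Cauchy_inequality)
      show "f holomorphic_on ball s r" "continuous_on (cball s r) f"
        using no1 by (auto intro!: holomorphic_on_imp_continuous_on holomorphic_on_subset[OF hol])
      fix x assume x: "norm (s - x) = r"
      have re: "\<bar>Re s - Re x\<bar> \<le> r" and im: "\<bar>Im s - Im x\<bar> \<le> r"
        using abs_Re_le_cmod[of "s - x"] abs_Im_le_cmod[of "s - x"] x by auto
      have "norm (f x) \<le> C * (1 + \<bar>Im x\<bar>) powr A"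
        by (rule C(3)) (use re im s r in linarith)+
      also have "\<dots> \<le> C * (2 * (1 + \<bar>Im s\<bar>)) powr A"
        using im r C(1) A by (intro mult_left_mono powr_mono2) auto
      finally show "norm (f x) \<le> C * 2 powr A * (1 + \<bar>Im s\<bar>) powr A"
        by (simp only: powr_mult mult.assoc)
    qed (use r in auto)
    then show "norm ((deriv ^^ k) f s) \<le> fact k * (C * 2 powr A) / r ^ k * (1 + \<bar>Im s\<bar>) powr A"
      by (simp add: mult_ac)
  qed
qed

text \<open>
  The maximum principle is applied on a rectangle of height proportional to \<open>\<bar>Im s0\<bar>\<close> around \<open>s0\<close>, which
  avoids the pole; the factor \<open>exp ((s - s0)\<^sup>2)\<close> makes the horizontal sides negligible.
\<close>

lemma strip_bound_three_lines:
  assumes hol: "f holomorphic_on - {1}" and ab: "a < b"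
    and fs: "strip_bound f a b A0" and fa: "strip_bound f a a A" and fb: "strip_bound f b b B"
    and AB: "A \<ge> 0" "B \<ge> 0" "A0 \<ge> 0" and cd: "a \<le> c" "d \<le> b"
    and th: "\<And>x. c \<le> x \<Longrightarrow> x \<le> d \<Longrightarrow> (A * (b - x) + B * (x - a)) / (b - a) \<le> \<theta>"
  shows "strip_bound f c d \<theta>"
proof -
  \<comment> \<open>The auxiliary function \<open>g\<close> below contains the factor
    \<open>p powr (\<kappa> (s - s0))\<close> with \<open>p = 1 + |t0|\<close>. This slope is the
    one for which the factor brings both vertical sides, of orders \<open>A\<close> and
    \<open>B\<close>, to the same order: the interpolated exponent at \<open>Re s0\<close>.\<close>
  define \<kappa> where "\<kappa> = (A - B) / (b - a)"
  obtain C0 T0 where C0: "C0 > 0" "T0 \<ge> 2"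
    "\<And>s. a \<le> Re s \<Longrightarrow> Re s \<le> b \<Longrightarrow> T0 \<le> \<bar>Im s\<bar> \<Longrightarrow> norm (f s) \<le> C0 * (1 + \<bar>Im s\<bar>) powr A0"
    by (rule strip_boundE[OF fs], rule that)
  obtain C1 T1 where C1: "C1 > 0" "T1 \<ge> 2"
    "\<And>s. a \<le> Re s \<Longrightarrow> Re s \<le> a \<Longrightarrow> T1 \<le> \<bar>Im s\<bar> \<Longrightarrow> norm (f s) \<le> C1 * (1 + \<bar>Im s\<bar>) powr A"
    by (rule strip_boundE[OF fa], rule that)
  obtain C2 T2 where C2: "C2 > 0" "T2 \<ge> 2"
    "\<And>s. b \<le> Re s \<Longrightarrow> Re s \<le> b \<Longrightarrow> T2 \<le> \<bar>Im s\<bar> \<Longrightarrow> norm (f s) \<le> C2 * (1 + \<bar>Im s\<bar>) powr B"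
    by (rule strip_boundE[OF fb], rule that)
  define C where "C = C0 + C1 + C2"
  define T where "T = T0 + T1 + T2"
  \<comment> \<open>On the horizontal sides, at distance \<open>|t0| / 2\<close> from
    \<open>s0\<close>, only the crude exponent \<open>A0\<close> is available, and the factor with
    slope \<open>\<kappa>\<close> costs at most exponent \<open>\<gamma>\<close>. The Gaussian decay
    beats both.\<close>
  define \<gamma> where "\<gamma> = \<bar>\<kappa>\<bar> * (b - a)"
  have "((\<lambda>t. (2 * (1 + t)) powr A0 * (1 + t) powr \<gamma> * exp (- (t / 2)\<^sup>2)) \<longlongrightarrow> 0) at_top"
    by real_asymp
  then have "eventually (\<lambda>t. (2 * (1 + t)) powr A0 * (1 + t) powr \<gamma> * exp (- (t / 2)\<^sup>2) < 1) at_top"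
    by (rule order_tendstoD) simp
  then obtain T' where T': "\<And>t. t \<ge> T' \<Longrightarrow> (2 * (1 + t)) powr A0 * (1 + t) powr \<gamma> * exp (- (t / 2)\<^sup>2) < 1"
    by (auto simp: eventually_at_top_linorder)
  define K where "K = C * 2 powr (A + B) * exp ((b - a)\<^sup>2)"
  have C: "C > 0" "C0 \<le> C" "C1 \<le> C" "C2 \<le> C" using C0 C1 C2 by (auto simp: C_def)
  show ?thesis
  proof (rule strip_boundI[of _ _ "max (2 * T) T'" _ K])
    fix s0 assume s0: "c \<le> Re s0" "Re s0 \<le> d" "max (2 * T) T' \<le> \<bar>Im s0\<bar>"
    define t0 where "t0 = Im s0"
    define x0 where "x0 = Re s0"
    define p where "p = 1 + \<bar>t0\<bar>"
    define \<theta>0 where "\<theta>0 = (A * (b - x0) + B * (x0 - a)) / (b - a)"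
    have x0: "a \<le> x0" "x0 \<le> b" using s0 cd by (auto simp: x0_def)
    have t0: "2 * T \<le> \<bar>t0\<bar>" "T' \<le> \<bar>t0\<bar>" using s0 by (auto simp: t0_def)
    have p: "p \<ge> 1" by (simp add: p_def)
    have \<theta>0: "\<theta>0 \<ge> 0" unfolding \<theta>0_def using AB x0 ab by simp
    have e1: "A + \<kappa> * (a - x0) = \<theta>0" and e2: "B + \<kappa> * (b - x0) = \<theta>0"
      unfolding \<theta>0_def \<kappa>_def using ab by (simp_all add: field_simps)
    define S where "S = cbox (Complex a (t0 - \<bar>t0\<bar> / 2)) (Complex b (t0 + \<bar>t0\<bar> / 2))"
    define g where "g = (\<lambda>s. f s * exp ((s - s0)\<^sup>2 + of_real (\<kappa> * ln p) * (s - s0)))"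
    have S: "a \<le> Re s" "Re s \<le> b" "\<bar>Im s - t0\<bar> \<le> \<bar>t0\<bar> / 2" if "s \<in> S" for s
    proof -
      have "a \<le> Re s" "Re s \<le> b" "t0 - \<bar>t0\<bar> / 2 \<le> Im s" "Im s \<le> t0 + \<bar>t0\<bar> / 2"
        using that by (auto simp: S_def in_cbox_complex_iff)
      then show "a \<le> Re s" "Re s \<le> b" "\<bar>Im s - t0\<bar> \<le> \<bar>t0\<bar> / 2" by linarith+
    qed
    have imS: "\<bar>Im s\<bar> \<ge> T" "1 + \<bar>Im s\<bar> \<le> 2 * p" if "s \<in> S" for s
    proof -
      have "\<bar>t0\<bar> - \<bar>Im s\<bar> \<le> \<bar>Im s - t0\<bar>" "\<bar>Im s\<bar> - \<bar>t0\<bar> \<le> \<bar>Im s - t0\<bar>" by linarith+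
      then have "\<bar>t0\<bar> / 2 \<le> \<bar>Im s\<bar>" "\<bar>Im s\<bar> \<le> \<bar>t0\<bar> + \<bar>t0\<bar> / 2" using S(3)[OF that] by simp_all
      moreover have "\<bar>t0\<bar> / 2 \<le> \<bar>t0\<bar>" by simp
      ultimately show "\<bar>Im s\<bar> \<ge> T" "1 + \<bar>Im s\<bar> \<le> 2 * p" using t0(1) by (simp_all add: p_def)
    qed
    have no1: "1 \<notin> S"
      using imS[of 1] C0 C1 C2 by (auto simp: T_def)
    have ng: "norm (g s) = norm (f s) * exp ((Re s - x0)\<^sup>2) * exp (- (Im s - t0)\<^sup>2) * p powr (\<kappa> * (Re s - x0))" for s
    proof -
      have "Re ((s - s0)\<^sup>2 + of_real (\<kappa> * ln p) * (s - s0))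
         = (Re s - x0)\<^sup>2 + - (Im s - t0)\<^sup>2 + \<kappa> * (Re s - x0) * ln p"
        by (simp add: power2_eq_square x0_def t0_def algebra_simps)
      then have "norm (exp ((s - s0)\<^sup>2 + of_real (\<kappa> * ln p) * (s - s0)))
         = exp ((Re s - x0)\<^sup>2 + - (Im s - t0)\<^sup>2 + \<kappa> * (Re s - x0) * ln p)"
        by (simp only: norm_exp_eq_Re)
      also have "\<dots> = exp ((Re s - x0)\<^sup>2) * exp (- (Im s - t0)\<^sup>2) * p powr (\<kappa> * (Re s - x0))"
        using p by (simp only: exp_add) (simp add: powr_def)
      finally show ?thesis unfolding g_def norm_mult by (simp only: mult.assoc)
    qed
    have ex: "exp ((Re s - x0)\<^sup>2) \<le> exp ((b - a)\<^sup>2)" if "s \<in> S" for s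
      using S[OF that] x0 by (auto simp: abs_le_square_iff[symmetric])
    have P0: "p powr \<theta>0 \<ge> 1" using ge_one_powr_ge_zero[OF p \<theta>0] .
    have side: "norm (g s) \<le> K * p powr \<theta>0"
      if s: "s \<in> S" and f: "norm (f s) \<le> C * (1 + \<bar>Im s\<bar>) powr D" and D: "0 \<le> D" "D \<le> A + B"
        "D + \<kappa> * (Re s - x0) = \<theta>0" for s D
    proof -
      have "norm (f s) \<le> C * (1 + \<bar>Im s\<bar>) powr D" by (rule f)
      also have "\<dots> \<le> C * (2 * p) powr D"
        using imS[OF s] C D by (intro mult_left_mono powr_mono2) auto
      also have "\<dots> = C * 2 powr D * p powr D" using p by (simp add: powr_mult)
      also have "\<dots> \<le> C * 2 powr (A + B) * p powr D"
        using C D by (intro mult_right_mono mult_left_mono powr_mono) auto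
      finally have f': "norm (f s) \<le> C * 2 powr (A + B) * p powr D" .
      have "norm (g s) \<le> C * 2 powr (A + B) * p powr D * exp ((b - a)\<^sup>2) * 1 * p powr (\<kappa> * (Re s - x0))"
        unfolding ng using C by (intro mult_mono f' ex[OF s]) auto
      also have "\<dots> = K * (p powr D * p powr (\<kappa> * (Re s - x0)))" by (simp add: K_def mult_ac)
      also have "p powr D * p powr (\<kappa> * (Re s - x0)) = p powr \<theta>0"
        using D(3) by (simp add: powr_add[symmetric])
      finally show ?thesis .
    qed
    have "norm (g s0) \<le> K * p powr \<theta>0"
    proof (rule maximum_modulus_frontier[of g S])
      show "bounded S" by (simp add: S_def)
      show "s0 \<in> S" using x0 by (simp add: S_def in_cbox_complex_iff x0_def t0_def)
      show "g holomorphic_on interior S" unfolding g_def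
        using no1 interior_subset[of S] by (intro holomorphic_intros holomorphic_on_subset[OF hol]) auto
      have "continuous_on S g" unfolding g_def
        using no1 by (intro continuous_intros holomorphic_on_imp_continuous_on holomorphic_on_subset[OF hol]) auto
      then show "continuous_on (closure S) g" by (simp add: S_def)
      fix s assume "s \<in> frontier S"
      then have s: "s \<in> S" and nb: "s \<notin> box (Complex a (t0 - \<bar>t0\<bar> / 2)) (Complex b (t0 + \<bar>t0\<bar> / 2))"
        by (auto simp: S_def frontier_def)
      note Ss = S[OF s] and Is = imS[OF s]
      have "Re s = a \<or> Re s = b \<or> \<bar>Im s - t0\<bar> = \<bar>t0\<bar> / 2"
        using nb Ss by (auto simp: in_box_complex_iff abs_if split: if_splits)
      then show "norm (g s) \<le> K * p powr \<theta>0"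
      proof (elim disjE)
        assume a: "Re s = a"
        show ?thesis
        proof (rule side[OF s, of A])
          have "norm (f s) \<le> C1 * (1 + \<bar>Im s\<bar>) powr A"
            using Is C0 C1 C2 a by (intro C1) (auto simp: T_def)
          also have "\<dots> \<le> C * (1 + \<bar>Im s\<bar>) powr A" using C by (intro mult_right_mono) auto
          finally show "norm (f s) \<le> C * (1 + \<bar>Im s\<bar>) powr A" .
        qed (use AB a e1 in auto)
      next
        assume b: "Re s = b"
        show ?thesis
        proof (rule side[OF s, of B])
          have "norm (f s) \<le> C2 * (1 + \<bar>Im s\<bar>) powr B"
            using Is C0 C1 C2 b by (intro C2) (auto simp: T_def)
          also have "\<dots> \<le> C * (1 + \<bar>Im s\<bar>) powr B" using C by (intro mult_right_mono) auto
          finally show "norm (f s) \<le> C * (1 + \<bar>Im s\<bar>) powr B" .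
        qed (use AB b e2 in auto)
      next
        assume im: "\<bar>Im s - t0\<bar> = \<bar>t0\<bar> / 2"
        have "norm (f s) \<le> C0 * (1 + \<bar>Im s\<bar>) powr A0"
          using Ss Is C0 C1 C2 by (intro C0) (auto simp: T_def)
        also have "\<dots> \<le> C * (2 * p) powr A0"
          using Is C AB by (intro mult_mono powr_mono2) auto
        finally have f': "norm (f s) \<le> C * (2 * p) powr A0" .
        have "\<bar>Re s - x0\<bar> \<le> b - a" using Ss x0 by linarith
        then have "\<kappa> * (Re s - x0) \<le> \<gamma>"
          using mult_mono[of "\<bar>\<kappa>\<bar>" "\<bar>\<kappa>\<bar>" "\<bar>Re s - x0\<bar>" "b - a"] abs_ge_self[of "\<kappa> * (Re s - x0)"]
          by (simp add: \<gamma>_def abs_mult)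
        then have pw: "p powr (\<kappa> * (Re s - x0)) \<le> p powr \<gamma>" using p by (intro powr_mono) auto
        have "(Im s - t0)\<^sup>2 = (\<bar>t0\<bar> / 2)\<^sup>2" by (metis im power2_abs)
        then have "norm (g s) \<le> C * (2 * p) powr A0 * exp ((b - a)\<^sup>2) * exp (- (\<bar>t0\<bar> / 2)\<^sup>2) * p powr \<gamma>"
          unfolding ng using C by (intro mult_mono f' ex[OF s] pw) auto
        also have "\<dots> = C * exp ((b - a)\<^sup>2) * ((2 * p) powr A0 * p powr \<gamma> * exp (- (\<bar>t0\<bar> / 2)\<^sup>2))"
          by (simp only: mult_ac)
        also have "\<dots> \<le> C * exp ((b - a)\<^sup>2) * 1"
          using T'[OF t0(2)] C by (intro mult_left_mono) (auto simp: p_def)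
        also have "\<dots> \<le> K * 1"
          using ge_one_powr_ge_zero[of 2 "A + B"] C AB by (simp add: K_def)
        also have "\<dots> \<le> K * p powr \<theta>0" using P0 C by (intro mult_left_mono) (auto simp: K_def)
        finally show ?thesis .
      qed
    qed
    moreover have "norm (g s0) = norm (f s0)" by (simp add: g_def)
    moreover have "K * p powr \<theta>0 \<le> K * p powr \<theta>"
      using th[of x0] s0 p C by (intro mult_left_mono powr_mono) (auto simp: \<theta>0_def x0_def K_def)
    ultimately show "norm (f s0) \<le> K * (1 + \<bar>Im s0\<bar>) powr \<theta>" by (simp add: p_def t0_def)
  qed
qed

section \<open>Transfer of the Lindelof bound between zeta and its derivatives\<close>

lemma Lindelof_iff_strip_bound:
  "Lindelof_Hypothesis \<longleftrightarrow> (\<forall>\<epsilon>>0. strip_bound zeta (1/2) (1/2) \<epsilon>)"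
proof (intro iffI allI impI)
  fix \<epsilon> :: real assume "Lindelof_Hypothesis" and e: "\<epsilon> > 0"
  then have "(\<lambda>t::real. norm (zeta (Complex (1/2) t))) \<in> O[at_infinity](\<lambda>t. \<bar>t\<bar> powr \<epsilon>)"
    unfolding Lindelof_Hypothesis_def by blast
  then obtain c where c: "c > 0"
    "eventually (\<lambda>t. norm (norm (zeta (Complex (1/2) t))) \<le> c * norm (\<bar>t\<bar> powr \<epsilon>)) at_infinity"
    by (rule landau_o.bigE)
  then obtain T where T: "\<And>t::real. T \<le> \<bar>t\<bar> \<Longrightarrow> norm (zeta (Complex (1/2) t)) \<le> c * \<bar>t\<bar> powr \<epsilon>"
    by (auto simp: eventually_at_infinity)
  show "strip_bound zeta (1/2) (1/2) \<epsilon>"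
  proof (rule strip_boundI[of _ _ T _ c])
    fix s assume s: "1/2 \<le> Re s" "Re s \<le> 1/2" "T \<le> \<bar>Im s\<bar>"
    then have "s = Complex (1/2) (Im s)" by (simp add: complex_eq_iff)
    then have "norm (zeta s) \<le> c * \<bar>Im s\<bar> powr \<epsilon>" using T[OF s(3)] by simp
    also have "\<dots> \<le> c * (1 + \<bar>Im s\<bar>) powr \<epsilon>"
      using c e by (intro mult_left_mono powr_mono2) auto
    finally show "norm (zeta s) \<le> c * (1 + \<bar>Im s\<bar>) powr \<epsilon>" .
  qed
next
  assume *: "\<forall>\<epsilon>>0. strip_bound zeta (1/2) (1/2) \<epsilon>"
  show "Lindelof_Hypothesis"
    unfolding Lindelof_Hypothesis_def
  proof (intro allI impI)
    fix \<epsilon> :: real assume e: "\<epsilon> > 0"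
    then have sb: "strip_bound zeta (1/2) (1/2) \<epsilon>" using * by simp
    obtain C T where C: "C > 0" "T \<ge> 2"
      "\<And>s. 1/2 \<le> Re s \<Longrightarrow> Re s \<le> 1/2 \<Longrightarrow> T \<le> \<bar>Im s\<bar> \<Longrightarrow> norm (zeta s) \<le> C * (1 + \<bar>Im s\<bar>) powr \<epsilon>"
      by (rule strip_boundE[OF sb], rule that)
    have "norm (zeta (Complex (1/2) t)) \<le> C * 2 powr \<epsilon> * \<bar>t\<bar> powr \<epsilon>" if "T \<le> \<bar>t\<bar>" for t
    proof -
      have "norm (zeta (Complex (1/2) t)) \<le> C * (1 + \<bar>t\<bar>) powr \<epsilon>"
        using C(3)[of "Complex (1/2) t"] that by simp
      also have "\<dots> \<le> C * (2 * \<bar>t\<bar>) powr \<epsilon>"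
        using C that e by (intro mult_left_mono powr_mono2) auto
      finally show ?thesis by (simp only: powr_mult mult.assoc)
    qed
    then show "(\<lambda>t::real. norm (zeta (Complex (1/2) t))) \<in> O[at_infinity](\<lambda>t. \<bar>t\<bar> powr \<epsilon>)"
      by (intro bigoI[of _ "C * 2 powr \<epsilon>"]) (auto simp: eventually_at_infinity intro!: exI[of _ T])
  qed
qed

lemma higher_deriv_zeta_holomorphic: "(deriv ^^ k) zeta holomorphic_on - {1}"
  by (intro holomorphic_higher_deriv zeta_holomorphic) auto

text \<open>Circles of radius 1/8 inside the strip from 1/4 to 3; the resulting strip still contains
  a neighbourhood of the critical line.\<close>

lemma strip_bound_higher_deriv_zeta: "strip_bound ((deriv ^^ k) zeta) (3/8) 2 1"
  by (rule strip_bound_mono[OF strip_bound_deriv[OF zeta_holomorphic strip_bound_zeta, of "1/8" k]]) auto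

lemma strip_bound_higher_deriv_zeta_right: "strip_bound ((deriv ^^ k) zeta) 2 2 0"
  by (rule strip_bound_mono[OF strip_bound_deriv[OF zeta_holomorphic strip_bound_zeta_right, of "1/8" k]]) auto

lemma strip_bound_higher_deriv_zeta_critical_strip:
  assumes "strip_bound ((deriv ^^ k) zeta) (1/2) (1/2) \<epsilon>" "\<epsilon> \<ge> 0"
  shows "strip_bound ((deriv ^^ k) zeta) (1/2) 2 \<epsilon>"
proof (rule strip_bound_three_lines[OF higher_deriv_zeta_holomorphic, of "1/2" 2 _ 1 \<epsilon> 0])
  show "strip_bound ((deriv ^^ k) zeta) (1/2) 2 1"
    by (rule strip_bound_mono[OF strip_bound_higher_deriv_zeta]) auto
  show "(\<epsilon> * (2 - x) + 0 * (x - 1/2)) / (2 - 1/2) \<le> \<epsilon>" if "1/2 \<le> x" "x \<le> 2" for x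
  proof -
    have "\<epsilon> * (2 - x) \<le> \<epsilon> * (2 - 1/2)" using that assms by (intro mult_left_mono) auto
    then show ?thesis by simp
  qed
qed (use assms strip_bound_higher_deriv_zeta_right in auto)

lemma strip_bound_higher_deriv_iff:
  "(\<forall>\<epsilon>>0. strip_bound ((deriv ^^ k) zeta) (1/2) (1/2) \<epsilon>) \<longleftrightarrow> (\<forall>\<epsilon>>0. strip_bound zeta (1/2) (1/2) \<epsilon>)"
proof (intro iffI allI impI)
  fix \<epsilon> :: real assume *: "\<forall>\<epsilon>>0. strip_bound zeta (1/2) (1/2) \<epsilon>" and e: "\<epsilon> > 0"
  \<comment> \<open>Interpolation between exponent 1 at 1/4 and \<open>\<epsilon>/2\<close> at 1/2
    gives at most \<open>4 (\<delta> + \<epsilon>/8)\<close> at \<open>1/2 - \<delta>\<close>, hence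
    at most \<open>\<epsilon>\<close> when \<open>\<delta> \<le> \<epsilon>/8\<close>. The bound 1/8
    keeps the circles of radius \<open>\<delta>\<close> to the right of 1/4.\<close>
  define \<delta> where "\<delta> = min (1/8) (\<epsilon> / 8)"
  have d: "\<delta> > 0" "\<delta> \<le> 1/8" "\<delta> \<le> \<epsilon> / 8" using e by (auto simp: \<delta>_def)
  have sb: "strip_bound zeta (1/2) (1/2) (\<epsilon>/2)" using * e by simp
  have "strip_bound zeta (1/2) 2 (\<epsilon>/2)"
    using strip_bound_higher_deriv_zeta_critical_strip[of 0 "\<epsilon>/2"] sb e by simp
  then have right: "strip_bound zeta (1/2) 2 \<epsilon>" by (rule strip_bound_mono) (use e in auto)
  have left: "strip_bound zeta (1/2 - \<delta>) (1/2) \<epsilon>"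
  proof (rule strip_bound_three_lines[OF zeta_holomorphic, of "1/4" "1/2" 1 1 "\<epsilon>/2"])
    show "(1 * (1/2 - x) + \<epsilon>/2 * (x - 1/4)) / (1/2 - 1/4) \<le> \<epsilon>" if "1/2 - \<delta> \<le> x" "x \<le> 1/2" for x
    proof -
      have "\<epsilon>/2 * (x - 1/4) \<le> \<epsilon>/2 * (1/4)" using that e by (intro mult_left_mono) auto
      moreover have "1/2 - x \<le> \<epsilon>/8" using that d by linarith
      ultimately have "1 * (1/2 - x) + \<epsilon>/2 * (x - 1/4) \<le> \<epsilon>/4" by simp
      then show ?thesis by simp
    qed
  qed (use sb e d in \<open>auto intro: strip_bound_mono[OF strip_bound_zeta]\<close>)
  show "strip_bound ((deriv ^^ k) zeta) (1/2) (1/2) \<epsilon>"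
    by (rule strip_bound_mono[OF strip_bound_deriv[OF zeta_holomorphic strip_bound_split[OF left right], of \<delta> k]])
       (use d e in auto)
next
  fix \<epsilon> :: real assume "\<forall>\<epsilon>>0. strip_bound ((deriv ^^ k) zeta) (1/2) (1/2) \<epsilon>" and e: "\<epsilon> > 0"
  then have "strip_bound ((deriv ^^ k) zeta) (1/2) (1/2) \<epsilon>" by simp
  then show "strip_bound zeta (1/2) (1/2) \<epsilon>"
  \<comment> \<open>The exponent is the same at each step, because the segment from
    \<open>Re s = 1/2\<close> to \<open>Re s = 2\<close> has the fixed length 3/2 and the lower
    derivative is bounded at its right end.\<close>
  proof (induction k)
    case (Suc k)
    have sb: "strip_bound ((deriv ^^ Suc k) zeta) (1/2) 2 \<epsilon>"
      using strip_bound_higher_deriv_zeta_critical_strip[OF Suc.prems] e by simp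
    obtain C T where C: "C > 0" "T \<ge> 2"
      "\<And>s. 1/2 \<le> Re s \<Longrightarrow> Re s \<le> 2 \<Longrightarrow> T \<le> \<bar>Im s\<bar> \<Longrightarrow> norm ((deriv ^^ Suc k) zeta s) \<le> C * (1 + \<bar>Im s\<bar>) powr \<epsilon>"
      by (rule strip_boundE[OF sb], rule that)
    obtain C' T' where C': "C' > 0" "T' \<ge> 2"
      "\<And>s. 2 \<le> Re s \<Longrightarrow> Re s \<le> 2 \<Longrightarrow> T' \<le> \<bar>Im s\<bar> \<Longrightarrow> norm ((deriv ^^ k) zeta s) \<le> C' * (1 + \<bar>Im s\<bar>) powr 0"
      by (rule strip_boundE[OF strip_bound_higher_deriv_zeta_right], rule that)
    have "strip_bound ((deriv ^^ k) zeta) (1/2) (1/2) \<epsilon>"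
    proof (rule strip_boundI[of _ _ "max T T'" _ "C' + 2 * C"])
      fix s assume s: "1/2 \<le> Re s" "Re s \<le> 1/2" "max T T' \<le> \<bar>Im s\<bar>"
      define S where "S = closed_segment s (s + 3/2)"
      define P where "P = (1 + \<bar>Im s\<bar>) powr \<epsilon>"
      have P: "P \<ge> 1" unfolding P_def using e by (intro ge_one_powr_ge_zero) auto
      have S: "Im z = Im s" "1/2 \<le> Re z" "Re z \<le> 2" if "z \<in> S" for z
      proof -
        have "\<exists>u. 0 \<le> u \<and> u \<le> 1 \<and> z = (1 - u) *\<^sub>R s + u *\<^sub>R (s + 3/2)"
          using that unfolding S_def in_segment .
        then obtain u where "0 \<le> u" "u \<le> 1" "z = (1 - u) *\<^sub>R s + u *\<^sub>R (s + 3/2)"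
          by (elim exE conjE) (rule that)
        then show "Im z = Im s" "1/2 \<le> Re z" "Re z \<le> 2" using s
          by (auto simp: algebra_simps)
      qed
      have "norm ((deriv ^^ k) zeta s - (deriv ^^ k) zeta (s + 3/2)) \<le> C * P * norm (s - (s + 3/2))"
      proof (rule field_differentiable_bound[of S _ "(deriv ^^ Suc k) zeta"])
        show "convex S" "s \<in> S" "s + 3/2 \<in> S" by (auto simp: S_def)
        fix z assume z: "z \<in> S"
        have z1: "z \<noteq> 1" using S[OF z] s C by auto
        show "((deriv ^^ k) zeta has_field_derivative (deriv ^^ Suc k) zeta z) (at z within S)"
          using holomorphic_derivI[OF higher_deriv_zeta_holomorphic[of k], of z S] z1 by (simp add: open_Compl)
        show "norm ((deriv ^^ Suc k) zeta z) \<le> C * P"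
          using C(3)[of z] S[OF z] s by (simp add: P_def)
      qed
      also have "norm (s - (s + 3/2)) \<le> 2" by (simp add: norm_minus_commute)
      finally have "norm ((deriv ^^ k) zeta s - (deriv ^^ k) zeta (s + 3/2)) \<le> C * P * 2"
        using C P by simp
      moreover have "norm ((deriv ^^ k) zeta (s + 3/2)) \<le> C' * P"
        proof -
        have "Re (s + 3/2) = 2" "Im (s + 3/2) = Im s" using s by simp_all
        then have "norm ((deriv ^^ k) zeta (s + 3/2)) \<le> C' * (1 + \<bar>Im s\<bar>) powr 0"
          using C'(3)[of "s + 3/2"] s by simp
        also have "\<dots> \<le> C' * P" using P C' by simp
        finally show ?thesis .
      qed
      ultimately show "norm ((deriv ^^ k) zeta s) \<le> (C' + 2 * C) * (1 + \<bar>Im s\<bar>) powr \<epsilon>"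
        using norm_triangle_ineq2[of "(deriv ^^ k) zeta s" "(deriv ^^ k) zeta (s + 3/2)"]
        unfolding P_def[symmetric] by (simp add: algebra_simps)
    qed
    then show ?case by (rule Suc.IH)
  qed simp
qed

section \<open>Moments on the critical line\<close>

text \<open>Suppose \<open>\<phi> t > p powr \<epsilon>\<close> with \<open>p = 1 + |t|\<close>.
  Half of this value persists on an interval of length of order \<open>1 / p\<close>, so the moment
  of order \<open>l \<ge> 4 / \<epsilon>\<close> is at least of order \<open>p ^ 4 / p ^ 3\<close>:
  one power is lost to the length and two to the Cauchy density. For large \<open>p\<close> this
  exceeds the fixed moment.\<close>

lemma growth_of_moments:
  fixes \<phi> :: "real \<Rightarrow> real"
  assumes nn: "\<And>t. \<phi> t \<ge> 0"
    and lip: "\<And>s t. T \<le> \<bar>t\<bar> \<Longrightarrow> \<bar>s - t\<bar> \<le> 1 \<Longrightarrow> \<phi> t - \<phi> s \<le> C * (1 + \<bar>t\<bar>) * \<bar>s - t\<bar>"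
    and \<alpha>: "\<alpha> > 0" and \<epsilon>: "\<epsilon> > 0"
    and int: "\<And>l. l \<ge> 1 \<Longrightarrow> integrable lborel (\<lambda>s. \<phi> s ^ l / (\<alpha>\<^sup>2 + (s - \<beta>)\<^sup>2))"
  shows "\<exists>T'. \<forall>t. T' \<le> \<bar>t\<bar> \<longrightarrow> \<phi> t \<le> (1 + \<bar>t\<bar>) powr \<epsilon>"
proof -
  define l where "l = nat \<lceil>4 / \<epsilon>\<rceil>"
  have "0 < 4 / \<epsilon>" using \<epsilon> by simp
  then have l: "l \<ge> 1" "real l \<ge> 4 / \<epsilon>" unfolding l_def by linarith+
  then have le: "\<epsilon> * real l \<ge> 4" using \<epsilon> by (simp add: field_simps)
  define I where "I = (LINT s|lborel. \<phi> s ^ l / (\<alpha>\<^sup>2 + (s - \<beta>)\<^sup>2))"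
  define D where "D = max C 1"
  \<comment> \<open>Collects \<open>2 ^ l\<close> from halving the value and \<open>2 D\<close> from
    the length \<open>\<delta>\<close> chosen below.\<close>
  define K where "K = 2 ^ l * 2 * D"
  have D: "D \<ge> 1" "C \<le> D" by (auto simp: D_def)
  have K: "K > 0" using D by (simp add: K_def)
  define B where "B = \<bar>\<beta>\<bar> + 1"
  have "filterlim (\<lambda>p. p ^ 4 / (K * p * (\<alpha>\<^sup>2 + (p + B)\<^sup>2))) at_top at_top"
    using K by real_asymp
  then have "eventually (\<lambda>p. p ^ 4 / (K * p * (\<alpha>\<^sup>2 + (p + B)\<^sup>2)) > I) at_top"
    by (simp add: filterlim_at_top_dense)
  then obtain P where P: "\<And>p. p \<ge> P \<Longrightarrow> p ^ 4 / (K * p * (\<alpha>\<^sup>2 + (p + B)\<^sup>2)) > I"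
    by (auto simp: eventually_at_top_linorder)
  show ?thesis
  proof (intro exI[of _ "max T P"] allI impI, rule ccontr)
    fix t assume t: "max T P \<le> \<bar>t\<bar>" and "\<not> \<phi> t \<le> (1 + \<bar>t\<bar>) powr \<epsilon>"
    define p where "p = 1 + \<bar>t\<bar>"
    have big: "\<phi> t > p powr \<epsilon>" using \<open>\<not> _\<close> by (simp add: p_def)
    have p: "p \<ge> 1" by (simp add: p_def)
    have pe: "p powr \<epsilon> \<ge> 1" using p \<epsilon> by (intro ge_one_powr_ge_zero) auto
    \<comment> \<open>So short that \<open>\<phi>\<close> drops by at most 1/2, which is at most
      half of \<open>p powr \<epsilon>\<close>.\<close>
    define \<delta> where "\<delta> = 1 / (2 * D * p)"
    have Dp: "D * p \<ge> 1" using mult_mono[of 1 D 1 p] D p by simp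
    have \<delta>: "\<delta> > 0" "\<delta> \<le> 1" unfolding \<delta>_def using Dp by (auto simp: field_simps)
    define c where "c = (p powr \<epsilon> / 2) ^ l / (\<alpha>\<^sup>2 + (p + B)\<^sup>2)"
    have low: "indicator {t..t+\<delta>} s * c \<le> \<phi> s ^ l / (\<alpha>\<^sup>2 + (s - \<beta>)\<^sup>2)" for s
    proof (cases "s \<in> {t..t+\<delta>}")
      case True
      then have st: "\<bar>s - t\<bar> \<le> \<delta>" by auto
      have "\<phi> t - \<phi> s \<le> C * p * \<bar>s - t\<bar>" using lip[of t s] t st \<delta> by (simp add: p_def)
      also have "\<dots> \<le> D * p * \<delta>" using D p st by (intro mult_mono) auto
      also have "\<dots> = 1/2" using D p by (simp add: \<delta>_def)
      finally have ph: "\<phi> s \<ge> p powr \<epsilon> / 2" using big pe by linarith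
      have "\<bar>s - \<beta>\<bar> \<le> \<bar>s - t\<bar> + \<bar>t\<bar> + \<bar>\<beta>\<bar>" by linarith
      then have "\<bar>s - \<beta>\<bar> \<le> p + B" using st \<delta> by (simp add: p_def B_def)
      then have "(s - \<beta>)\<^sup>2 \<le> (p + B)\<^sup>2" using power_mono[of "\<bar>s - \<beta>\<bar>" "p + B" 2] by simp
      moreover have "0 < \<alpha>\<^sup>2 + (s - \<beta>)\<^sup>2" using \<alpha> by (simp add: add_pos_nonneg)
      ultimately have "c \<le> \<phi> s ^ l / (\<alpha>\<^sup>2 + (s - \<beta>)\<^sup>2)" unfolding c_def
        using ph nn by (intro frac_le power_mono) auto
      then show ?thesis using True by simp
    qed (use nn in auto)
    have "\<delta> * c = (LINT s|lborel. indicator {t..t+\<delta>} s * c)" using \<delta> by simp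
    also have "\<dots> \<le> I" unfolding I_def
      by (intro integral_mono low int l integrable_mult_left integrable_real_indicator) (use \<delta> in auto)
    finally have up: "\<delta> * c \<le> I" .
    have pl: "p ^ 4 \<le> (p powr \<epsilon>) ^ l"
    proof -
      have "p ^ 4 = p powr 4" using p by (simp add: powr_numeral)
      also have "\<dots> \<le> p powr (\<epsilon> * real l)" using p le by (intro powr_mono) auto
      also have "\<dots> = (p powr \<epsilon>) ^ l" using p by (simp add: powr_powr[symmetric] powr_realpow)
      finally show ?thesis .
    qed
    have pos: "0 < \<alpha>\<^sup>2 + (p + B)\<^sup>2" using \<alpha> by (simp add: add_pos_nonneg)
    have "I < p ^ 4 / (K * p * (\<alpha>\<^sup>2 + (p + B)\<^sup>2))"
      using t by (intro P) (auto simp: p_def)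
    also have "\<dots> \<le> (p powr \<epsilon>) ^ l / (K * p * (\<alpha>\<^sup>2 + (p + B)\<^sup>2))"
      using pl K p pos by (intro divide_right_mono) auto
    also have "\<dots> = \<delta> * c"
      unfolding \<delta>_def c_def K_def by (simp add: power_divide field_simps)
    finally show False using up by simp
  qed
qed

text \<open>The next derivative grows at most linearly on the critical line, and the mean value
  inequality on a vertical segment turns this into a Lipschitz constant. The threshold
  \<open>T + 1\<close> keeps the whole segment in the range of that bound.\<close>

lemma higher_deriv_zeta_lipschitz:
  "\<exists>C T. \<forall>s t. T \<le> \<bar>t\<bar> \<longrightarrow> \<bar>s - t\<bar> \<le> 1 \<longrightarrow>
     norm ((deriv ^^ k) zeta (Complex (1/2) t)) - norm ((deriv ^^ k) zeta (Complex (1/2) s))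
       \<le> C * (1 + \<bar>t\<bar>) * \<bar>s - t\<bar>"
proof -
  obtain C T where C: "C > 0" "T \<ge> 2"
    "\<And>s. 3/8 \<le> Re s \<Longrightarrow> Re s \<le> 2 \<Longrightarrow> T \<le> \<bar>Im s\<bar> \<Longrightarrow> norm ((deriv ^^ Suc k) zeta s) \<le> C * (1 + \<bar>Im s\<bar>) powr 1"
    by (rule strip_boundE[OF strip_bound_higher_deriv_zeta], rule that)
  show ?thesis
  proof (rule exI[of _ "2 * C"], rule exI[of _ "T + 1"], intro allI impI)
    fix s t :: real assume t: "T + 1 \<le> \<bar>t\<bar>" "\<bar>s - t\<bar> \<le> 1"
    define S where "S = closed_segment (Complex (1/2) t) (Complex (1/2) s)"
    have S: "Re z = 1/2" "\<bar>Im z - t\<bar> \<le> 1" if "z \<in> S" for z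
    proof -
      have "\<exists>u. 0 \<le> u \<and> u \<le> 1 \<and> z = (1 - u) *\<^sub>R Complex (1/2) t + u *\<^sub>R Complex (1/2) s"
        using that unfolding S_def in_segment .
      then obtain u where u: "0 \<le> u" "u \<le> 1" "z = (1 - u) *\<^sub>R Complex (1/2) t + u *\<^sub>R Complex (1/2) s"
        by (elim exE conjE) (rule that)
      show "Re z = 1/2" unfolding u(3) by (simp add: algebra_simps)
      have "Im z - t = u * (s - t)" unfolding u(3) by (simp add: algebra_simps)
      then show "\<bar>Im z - t\<bar> \<le> 1" using u t mult_mono[of u 1 "\<bar>s - t\<bar>" 1] by (simp add: abs_mult)
    qed
    have "norm ((deriv ^^ k) zeta (Complex (1/2) t) - (deriv ^^ k) zeta (Complex (1/2) s))
        \<le> 2 * C * (1 + \<bar>t\<bar>) * norm (Complex (1/2) t - Complex (1/2) s)"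
    proof (rule field_differentiable_bound[of S _ "(deriv ^^ Suc k) zeta"])
      show "convex S" "Complex (1/2) t \<in> S" "Complex (1/2) s \<in> S" by (auto simp: S_def)
      fix z assume z: "z \<in> S"
      have z1: "z \<noteq> 1" using S[OF z] by auto
      then show "((deriv ^^ k) zeta has_field_derivative (deriv ^^ Suc k) zeta z) (at z within S)"
        using holomorphic_derivI[OF higher_deriv_zeta_holomorphic[of k], of z S] by (simp add: open_Compl)
      have "\<bar>Im z\<bar> \<le> \<bar>t\<bar> + 1" "T \<le> \<bar>Im z\<bar>" using S(2)[OF z] t by linarith+
      then have "norm ((deriv ^^ Suc k) zeta z) \<le> C * (1 + \<bar>Im z\<bar>) powr 1"
        using S[OF z] by (intro C) auto
      also have "\<dots> = C * (1 + \<bar>Im z\<bar>)" by simp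
      also have "\<dots> \<le> C * (2 * (1 + \<bar>t\<bar>))" 
        using C(1) \<open>\<bar>Im z\<bar> \<le> \<bar>t\<bar> + 1\<close> by (intro mult_left_mono) auto
      finally show "norm ((deriv ^^ Suc k) zeta z) \<le> 2 * C * (1 + \<bar>t\<bar>)" by (simp add: mult_ac)
    qed
    also have "Complex (1/2) t - Complex (1/2) s = \<i> * of_real (t - s)"
      by (simp add: complex_eq_iff)
    also have "norm \<dots> = \<bar>s - t\<bar>" by (simp only: norm_mult norm_of_real) (simp add: abs_minus_commute)
    finally show "norm ((deriv ^^ k) zeta (Complex (1/2) t)) - norm ((deriv ^^ k) zeta (Complex (1/2) s))
       \<le> 2 * C * (1 + \<bar>t\<bar>) * \<bar>s - t\<bar>"
      using norm_triangle_ineq2[of "(deriv ^^ k) zeta (Complex (1/2) t)" "(deriv ^^ k) zeta (Complex (1/2) s)"] by linarith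
  qed
qed

lemma Lindelof_of_moments:
  assumes \<alpha>: "\<alpha> > 0"
    and int: "\<And>l. l \<ge> 1 \<Longrightarrow> integrable lborel
      (\<lambda>s. norm ((deriv ^^ k) zeta (Complex (1/2) s)) ^ l / (\<alpha>\<^sup>2 + (s - \<beta>)\<^sup>2))"
  shows Lindelof_Hypothesis
proof -
  obtain C T where CT: "\<And>s t. T \<le> \<bar>t\<bar> \<Longrightarrow> \<bar>s - t\<bar> \<le> 1 \<Longrightarrow>
     norm ((deriv ^^ k) zeta (Complex (1/2) t)) - norm ((deriv ^^ k) zeta (Complex (1/2) s))
       \<le> C * (1 + \<bar>t\<bar>) * \<bar>s - t\<bar>"
    using higher_deriv_zeta_lipschitz by metis
  have "strip_bound ((deriv ^^ k) zeta) (1/2) (1/2) \<epsilon>" if e: "\<epsilon> > 0" for \<epsilon>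
  proof -
    obtain T' where T': "\<And>t. T' \<le> \<bar>t\<bar> \<Longrightarrow> norm ((deriv ^^ k) zeta (Complex (1/2) t)) \<le> (1 + \<bar>t\<bar>) powr \<epsilon>"
      using growth_of_moments[OF norm_ge_zero CT \<alpha> e int] by metis
    show ?thesis
    proof (rule strip_boundI[of _ _ T' _ 1])
      fix s assume s: "1/2 \<le> Re s" "Re s \<le> 1/2" "T' \<le> \<bar>Im s\<bar>"
      then have "s = Complex (1/2) (Im s)" by (simp add: complex_eq_iff)
      then show "norm ((deriv ^^ k) zeta s) \<le> 1 * (1 + \<bar>Im s\<bar>) powr \<epsilon>" using T'[OF s(3)] by simp
    qed
  qed
  then show ?thesis
    using strip_bound_higher_deriv_iff[of k] unfolding Lindelof_iff_strip_bound by blast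
qed

lemma continuous_on_critical_line:
  "continuous_on UNIV (\<lambda>t::real. (deriv ^^ k) zeta (Complex (1/2) t))"
proof -
  have "continuous_on UNIV (\<lambda>t::real. Complex (1/2) t)" by (intro continuous_intros)
  moreover have "(\<lambda>t::real. Complex (1/2) t) ` UNIV \<subseteq> - {1}" by (auto simp: complex_eq_iff)
  ultimately show ?thesis
    by (rule continuous_on_compose2[OF holomorphic_on_imp_continuous_on[OF higher_deriv_zeta_holomorphic]])
qed

text \<open>Below the threshold of the strip bound the continuous function is bounded by
  compactness, and \<open>(1 + |t|) powr \<epsilon> \<ge> 1\<close> lets one constant cover both
  ranges.\<close>

lemma Lindelof_imp_growth:
  assumes LH: Lindelof_Hypothesis and e: "\<epsilon> > 0"
  shows "\<exists>C. C > 0 \<and> (\<forall>t. norm ((deriv ^^ k) zeta (Complex (1/2) t)) \<le> C * (1 + \<bar>t\<bar>) powr \<epsilon>)"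
proof -
  let ?f = "\<lambda>t. (deriv ^^ k) zeta (Complex (1/2) t)"
  have sb: "strip_bound ((deriv ^^ k) zeta) (1/2) (1/2) \<epsilon>"
    using LH e strip_bound_higher_deriv_iff[of k] unfolding Lindelof_iff_strip_bound by blast
  obtain C T where C: "C > 0" "T \<ge> 2"
    "\<And>s. 1/2 \<le> Re s \<Longrightarrow> Re s \<le> 1/2 \<Longrightarrow> T \<le> \<bar>Im s\<bar> \<Longrightarrow> norm ((deriv ^^ k) zeta s) \<le> C * (1 + \<bar>Im s\<bar>) powr \<epsilon>"
    by (rule strip_boundE[OF sb], rule that)
  have "compact (?f ` {-T..T})"
    by (intro compact_continuous_image continuous_on_subset[OF continuous_on_critical_line]) auto
  then obtain B where B: "\<And>t. t \<in> {-T..T} \<Longrightarrow> norm (?f t) \<le> B"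
    using compact_imp_bounded bounded_iff by (metis imageI)
  show ?thesis
  proof (intro exI[of _ "C + \<bar>B\<bar>"] conjI allI)
    show "C + \<bar>B\<bar> > 0" using C by simp
    fix t
    have P: "(1 + \<bar>t\<bar>) powr \<epsilon> \<ge> 1" using e by (intro ge_one_powr_ge_zero) auto
    show "norm (?f t) \<le> (C + \<bar>B\<bar>) * (1 + \<bar>t\<bar>) powr \<epsilon>"
    proof (cases "T \<le> \<bar>t\<bar>")
      case True
      then have "norm (?f t) \<le> C * (1 + \<bar>t\<bar>) powr \<epsilon>" using C(3)[of "Complex (1/2) t"] by simp
      also have "\<dots> \<le> (C + \<bar>B\<bar>) * (1 + \<bar>t\<bar>) powr \<epsilon>" by (intro mult_right_mono) auto
      finally show ?thesis .
    next
      case False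
      then have "norm (?f t) \<le> B" by (intro B) auto
      also have "B \<le> (C + \<bar>B\<bar>) * 1" using C by simp
      also have "\<dots> \<le> (C + \<bar>B\<bar>) * (1 + \<bar>t\<bar>) powr \<epsilon>" using P C by (intro mult_left_mono) auto
      finally show ?thesis .
    qed
  qed
qed

section \<open>Angle doubling\<close>

text \<open>A density on the whole line, not a restricted space, keeps \<open>borel\<close> as the
  sigma-algebra, so that dilations and \<open>frac\<close> need no domain conditions. The interval
  is half-open to match the cells of the floor function.\<close>

definition unit_measure :: "real measure" where
  "unit_measure = density lborel (indicator {0..<1})"

lemma sets_unit_measure [simp, measurable_cong]: "sets unit_measure = sets borel"
  by (simp add: unit_measure_def)

lemma space_unit_measure [simp]: "space unit_measure = UNIV"
  by (simp add: unit_measure_def)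

lemma nn_integral_unit_measure:
  "f \<in> borel_measurable borel \<Longrightarrow>
     (\<integral>\<^sup>+w. f w \<partial>unit_measure) = (\<integral>\<^sup>+w. f w * indicator {0..<1} w \<partial>lborel)"
  unfolding unit_measure_def by (subst nn_integral_density) (auto simp: mult.commute)

lemma emeasure_unit_measure:
  "A \<in> sets borel \<Longrightarrow> emeasure unit_measure A = emeasure lborel (A \<inter> {0..<1})"
  unfolding unit_measure_def
  by (subst emeasure_density) (auto simp: indicator_inter_arith[symmetric] Int_commute)

lemma prob_space_unit_measure: "prob_space unit_measure"
  by (rule prob_spaceI) (simp add: emeasure_unit_measure)

interpretation unit_measure: prob_space unit_measure
  by (rule prob_space_unit_measure)

lemma AE_unit_measure: "AE w in unit_measure. 0 \<le> w \<and> w < 1"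
  unfolding unit_measure_def by (subst AE_density) (auto simp: indicator_def)

text \<open>The cells of length \<open>1 / N\<close> partition the half-open interval, and an affine
  change of variables stretches each of them to full length.\<close>

lemma nn_integral_unit_measure_split:
  fixes f :: "real \<Rightarrow> ennreal"
  assumes f [measurable]: "f \<in> borel_measurable borel" and N: "N > 0"
  shows "(\<integral>\<^sup>+w. f w \<partial>unit_measure) =
     (\<Sum>i<N. ennreal (1 / real N) * (\<integral>\<^sup>+v. f ((real i + v) / real N) \<partial>unit_measure))"
proof -
  let ?A = "\<lambda>i::nat. {real i / real N..<(real i + 1) / real N}"
  have iff: "w \<in> ?A i \<longleftrightarrow> 0 \<le> w \<and> i = nat \<lfloor>real N * w\<rfloor>" for w i
  proof
    assume "w \<in> ?A i"
    then have w: "real i \<le> real N * w" "real N * w < real i + 1" using N by (auto simp: field_simps)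
    then have "0 \<le> real N * w" by linarith
    then have "0 \<le> w" using N by (simp add: zero_le_mult_iff)
    moreover have "\<lfloor>real N * w\<rfloor> = int i" using w by (intro floor_unique) auto
    ultimately show "0 \<le> w \<and> i = nat \<lfloor>real N * w\<rfloor>" by simp
  next
    assume *: "0 \<le> w \<and> i = nat \<lfloor>real N * w\<rfloor>"
    then have "real_of_int \<lfloor>real N * w\<rfloor> = real i" by simp
    then have "real i \<le> real N * w" "real N * w < real i + 1" by linarith+
    then show "w \<in> ?A i" using N by (auto simp: field_simps)
  qed
  have ind: "indicator {0..<1} w = (\<Sum>i<N. indicator (?A i) w :: ennreal)" for w :: real
  proof -
    have "(\<Sum>i<N. indicator (?A i) w :: ennreal) = (\<Sum>i<N. if i = nat \<lfloor>real N * w\<rfloor> then (if 0 \<le> w then 1 else 0) else 0)"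
      by (intro sum.cong refl) (unfold indicator_def iff, auto)
    also have "\<dots> = (if nat \<lfloor>real N * w\<rfloor> < N then (if 0 \<le> w then 1 else 0) else 0)"
      by (subst sum.delta) auto
    also have "\<dots> = indicator {0..<1} w"
    proof (cases "0 \<le> w")
      case True
      then have "nat \<lfloor>real N * w\<rfloor> < N \<longleftrightarrow> real N * w < real N * 1"
        using N by (simp add: nat_less_iff floor_less_iff)
      then show ?thesis using True N by (simp add: indicator_def)
    qed simp
    finally show ?thesis ..
  qed
  have "(\<integral>\<^sup>+w. f w \<partial>unit_measure) = (\<integral>\<^sup>+w. (\<Sum>i<N. f w * indicator (?A i) w) \<partial>lborel)"
    by (simp add: nn_integral_unit_measure ind sum_distrib_left)
  also have "\<dots> = (\<Sum>i<N. \<integral>\<^sup>+w. f w * indicator (?A i) w \<partial>lborel)"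
    by (intro nn_integral_sum) auto
  also have "\<dots> = (\<Sum>i<N. ennreal (1 / real N) * (\<integral>\<^sup>+v. f ((real i + v) / real N) \<partial>unit_measure))"
  proof (intro sum.cong refl)
    fix i assume "i \<in> {..<N}"
    have "(\<integral>\<^sup>+w. f w * indicator (?A i) w \<partial>lborel) =
       ennreal (1 / real N) * (\<integral>\<^sup>+v. f (real i / real N + 1 / real N * v) *
          indicator (?A i) (real i / real N + 1 / real N * v) \<partial>lborel)"
      using N by (subst nn_integral_real_affine[where c = "1 / real N" and t = "real i / real N"]) auto
    also have "(\<lambda>v. f (real i / real N + 1 / real N * v) * indicator (?A i) (real i / real N + 1 / real N * v))
       = (\<lambda>v. f ((real i + v) / real N) * indicator {0..<1} v)"
      using N by (auto simp: indicator_def add_divide_distrib[symmetric] divide_le_cancel divide_less_cancel fun_eq_iff)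
    finally show "(\<integral>\<^sup>+w. f w * indicator (?A i) w \<partial>lborel) =
       ennreal (1 / real N) * (\<integral>\<^sup>+v. f ((real i + v) / real N) \<partial>unit_measure)"
      by (simp add: nn_integral_unit_measure)
  qed
  finally show ?thesis .
qed

lemma borel_measurable_frac [measurable]: "(frac :: real \<Rightarrow> real) \<in> borel_measurable borel"
  unfolding frac_def[abs_def] by measurable

text \<open>Independence of the leading base-\<open>N\<close> digit and the remaining fractional
  part: on each of the \<open>N\<close> cells \<open>g\<close> is constant, and the integral of
  \<open>H\<close> is the same for all cells.\<close>

lemma nn_integral_digits_product:
  fixes g :: "int \<Rightarrow> ennreal" and H :: "real \<Rightarrow> ennreal"
  assumes H [measurable]: "H \<in> borel_measurable borel" and N: "N > 0"
  shows "(\<integral>\<^sup>+w. g \<lfloor>real N * w\<rfloor> * H (frac (real N * w)) \<partial>unit_measure) =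
     (\<integral>\<^sup>+w. g \<lfloor>real N * w\<rfloor> \<partial>unit_measure) * (\<integral>\<^sup>+w. H w \<partial>unit_measure)"
proof -
  have *: "\<lfloor>real N * ((real i + v) / real N)\<rfloor> = int i" "frac (real N * ((real i + v) / real N)) = v"
    if "0 \<le> v \<and> v < 1" for v i
  proof -
    have "real N * ((real i + v) / real N) = real i + v" using N by simp
    moreover have "\<lfloor>real i + v\<rfloor> = int i" using that by (intro floor_unique) auto
    ultimately show "\<lfloor>real N * ((real i + v) / real N)\<rfloor> = int i" "frac (real N * ((real i + v) / real N)) = v"
      by (simp_all add: frac_def)
  qed
  have "(\<integral>\<^sup>+w. g \<lfloor>real N * w\<rfloor> * H (frac (real N * w)) \<partial>unit_measure)
     = (\<Sum>i<N. ennreal (1 / real N) * (\<integral>\<^sup>+v. g (int i) * H v \<partial>unit_measure))"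
    by (subst nn_integral_unit_measure_split[OF _ N], measurable)
       (intro sum.cong arg_cong2[where f = "(*)"] refl nn_integral_cong_AE eventually_mono[OF AE_unit_measure],
        simp_all only: *)
  also have "\<dots> = (\<Sum>i<N. ennreal (1 / real N) * g (int i)) * (\<integral>\<^sup>+w. H w \<partial>unit_measure)"
    by (simp add: nn_integral_cmult sum_distrib_right mult.assoc)
  also have "(\<Sum>i<N. ennreal (1 / real N) * g (int i)) = (\<Sum>i<N. ennreal (1 / real N) * (\<integral>\<^sup>+v. g (int i) \<partial>unit_measure))"
    by (simp add: unit_measure.emeasure_space_1[simplified])
  also have "\<dots> = (\<integral>\<^sup>+w. g \<lfloor>real N * w\<rfloor> \<partial>unit_measure)"
    by (subst nn_integral_unit_measure_split[OF _ N], measurable)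
       (intro sum.cong arg_cong2[where f = "(*)"] refl nn_integral_cong_AE eventually_mono[OF AE_unit_measure],
        simp_all only: *)
  finally show ?thesis .
qed

lemma nn_integral_frac_invariant:
  fixes H :: "real \<Rightarrow> ennreal"
  assumes H: "H \<in> borel_measurable borel" and N: "N > 0"
  shows "(\<integral>\<^sup>+w. H (frac (real N * w)) \<partial>unit_measure) = (\<integral>\<^sup>+w. H w \<partial>unit_measure)"
  using nn_integral_digits_product[OF assms, of "\<lambda>_. 1"] by (simp add: unit_measure.emeasure_space_1[simplified])

lemma measure_frac_invariant:
  assumes A [measurable]: "A \<in> sets borel" and N: "N > 0"
  shows "measure unit_measure {w. frac (real N * w) \<in> A} = measure unit_measure A"
proof -
  have m: "{w. frac (real N * w) \<in> A} \<in> sets borel" by measurable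
  have "emeasure unit_measure {w. frac (real N * w) \<in> A} =
    (\<integral>\<^sup>+w. indicator {w. frac (real N * w) \<in> A} w \<partial>unit_measure)"
    using m by (subst nn_integral_indicator) auto
  also have "\<dots> = (\<integral>\<^sup>+w. indicator A (frac (real N * w)) \<partial>unit_measure)"
    by (intro nn_integral_cong) (simp add: indicator_def)
  also have "\<dots> = (\<integral>\<^sup>+w. indicator A w \<partial>unit_measure)" by (rule nn_integral_frac_invariant[OF _ N]) simp
  finally show ?thesis by (simp add: measure_def)
qed

text \<open>Depends on the first \<open>m\<close> binary digits only; \<open>frac\<close> makes it
  periodic with period 1, so that \<open>2 ^ j * w\<close> need not be reduced before
  evaluation.\<close>

definition dyadic_step :: "(int \<Rightarrow> real) \<Rightarrow> nat \<Rightarrow> real \<Rightarrow> real" where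
  "dyadic_step G m w = G \<lfloor>2 ^ m * frac w\<rfloor>"

lemma borel_measurable_dyadic_step [measurable]: "dyadic_step G m \<in> borel_measurable borel"
  unfolding dyadic_step_def[abs_def] by measurable

lemma frac_power2_frac: "frac (2 ^ n * frac w) = frac (2 ^ n * (w::real))"
proof -
  have "2 ^ n * w = 2 ^ n * frac w + of_int (2 ^ n * \<lfloor>w\<rfloor>)" by (simp add: frac_def algebra_simps)
  then show ?thesis by (metis frac_add_of_int_right)
qed

lemma dyadic_step_frac: "dyadic_step G m (2 ^ n * frac w) = dyadic_step G m (2 ^ n * w)"
  by (simp add: dyadic_step_def frac_power2_frac)

text \<open>Shifts by multiples of \<open>m\<close> read disjoint blocks of \<open>m\<close> digits.
  The induction splits off the first block, with base \<open>2 ^ m\<close>; the weights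
  \<open>c\<close> must vary because the tail carries the shifted weights.\<close>

lemma mgf_dyadic_step:
  "(\<integral>\<^sup>+w. ennreal (exp (\<Sum>i<J. c i * dyadic_step G m (2 ^ (m * i) * w))) \<partial>unit_measure) =
   (\<Prod>i<J. \<integral>\<^sup>+w. ennreal (exp (c i * dyadic_step G m w)) \<partial>unit_measure)"
proof (induction J arbitrary: c)
  case 0
  then show ?case by (simp add: unit_measure.emeasure_space_1[simplified])
next
  case (Suc J)
  define H where "H = (\<lambda>v. ennreal (exp (\<Sum>i<J. c (Suc i) * dyadic_step G m (2 ^ (m * i) * v))))"
  have Hm: "H \<in> borel_measurable borel" unfolding H_def by measurable
  have "(\<integral>\<^sup>+w. ennreal (exp (\<Sum>i<Suc J. c i * dyadic_step G m (2 ^ (m * i) * w))) \<partial>unit_measure) =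
    (\<integral>\<^sup>+w. ennreal (exp (c 0 * G \<lfloor>real (2 ^ m) * w\<rfloor>)) * H (frac (real (2 ^ m) * w)) \<partial>unit_measure)"
  proof (intro nn_integral_cong_AE eventually_mono[OF AE_unit_measure])
    fix w :: real assume w: "0 \<le> w \<and> w < 1"
    have "dyadic_step G m (2 ^ (m * Suc i) * w) = dyadic_step G m (2 ^ (m * i) * frac (2 ^ m * w))" for i
      by (simp add: dyadic_step_frac power_add mult_ac)
    moreover have "dyadic_step G m w = G \<lfloor>2 ^ m * w\<rfloor>"
      using w by (simp add: dyadic_step_def frac_eq[THEN iffD2])
    ultimately show "ennreal (exp (\<Sum>i<Suc J. c i * dyadic_step G m (2 ^ (m * i) * w))) =
      ennreal (exp (c 0 * G \<lfloor>real (2 ^ m) * w\<rfloor>)) * H (frac (real (2 ^ m) * w))"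
      unfolding sum.lessThan_Suc_shift H_def by (simp add: exp_add ennreal_mult)
  qed
  also have "\<dots> = (\<integral>\<^sup>+w. ennreal (exp (c 0 * G \<lfloor>real (2 ^ m) * w\<rfloor>)) \<partial>unit_measure) * (\<integral>\<^sup>+w. H w \<partial>unit_measure)"
    by (rule nn_integral_digits_product[OF Hm, where g = "\<lambda>i. ennreal (exp (c 0 * G i))"]) simp
  also have "(\<integral>\<^sup>+w. ennreal (exp (c 0 * G \<lfloor>real (2 ^ m) * w\<rfloor>)) \<partial>unit_measure) =
     (\<integral>\<^sup>+w. ennreal (exp (c 0 * dyadic_step G m w)) \<partial>unit_measure)"
    by (intro nn_integral_cong_AE eventually_mono[OF AE_unit_measure])
       (simp add: dyadic_step_def frac_eq[THEN iffD2])
  also have "(\<integral>\<^sup>+w. H w \<partial>unit_measure) = (\<Prod>i<J. \<integral>\<^sup>+w. ennreal (exp (c (Suc i) * dyadic_step G m w)) \<partial>unit_measure)"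
    unfolding H_def by (rule Suc.IH)
  finally show ?case by (simp only: prod.lessThan_Suc_shift)
qed

text \<open>Every residue class gets the same number of terms; the conditional pads the last,
  incomplete block with zeros.\<close>

lemma sum_residue_classes:
  fixes a :: "nat \<Rightarrow> real"
  assumes "m > 0"
  shows "(\<Sum>j<k. a j) = (\<Sum>r<m. \<Sum>i<k div m + 1. if r + m * i < k then a (r + m * i) else 0)"
proof -
  let ?b = "\<lambda>j. if j < k then a j else 0"
  let ?J = "k div m + 1"
  have kJ: "k \<le> ?J * m" using assms by (metis add.commute div_mult_mod_eq less_imp_le mod_less_divisor 
        add_mult_distrib mult_1 add_le_cancel_left plus_1_eq_Suc Suc_eq_plus1)
  have "(\<Sum>j<k. a j) = (\<Sum>j<?J * m. ?b j)"
    using kJ by (intro sum.mono_neutral_cong_left) auto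
  also have "\<dots> = (\<Sum>i<?J. \<Sum>j\<in>{i * m..<i * m + m}. ?b j)" by (rule sum.nat_group[symmetric])
  also have "\<dots> = (\<Sum>i<?J. \<Sum>r<m. ?b (r + m * i))"
  proof (rule sum.cong[OF refl])
    fix i
    have "(\<Sum>j\<in>{i * m..<i * m + m}. ?b j) = (\<Sum>r\<in>{0..<m}. ?b (r + i * m))"
      using sum.shift_bounds_nat_ivl[of ?b 0 "i * m" m] by (simp add: add.commute)
    then show "(\<Sum>j\<in>{i * m..<i * m + m}. ?b j) = (\<Sum>r<m. ?b (r + m * i))"
      by (simp add: lessThan_atLeast0 mult.commute[of m i] cong: if_cong)
  qed
  also have "\<dots> = (\<Sum>r<m. \<Sum>i<?J. ?b (r + m * i))" by (rule sum.swap)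
  finally show ?thesis .
qed


text \<open>
  The shifts \<open>2 ^ j\<close> with \<open>j\<close> in one residue class modulo \<open>m\<close> give independent variables; convexity
  of \<open>exp\<close> reduces the moment generating function of the whole sum to those of the \<open>m\<close> classes.
\<close>

lemma chernoff_dyadic_step:
  assumes G: "\<And>i. \<bar>G i\<bar> \<le> M" and M: "M > 0" and m: "0 < m" "m \<le> k" and \<eta>: "\<eta> > 0"
  shows "measure unit_measure
     {w. real k * ((\<integral>w. dyadic_step G m w \<partial>unit_measure) + \<eta>) \<le> (\<Sum>j<k. dyadic_step G m (2 ^ j * w))}
     \<le> exp (- (\<eta>\<^sup>2 * real k / (4 * real m * M\<^sup>2)))"
proof -
  define \<mu> where "\<mu> = (\<integral>w. dyadic_step G m w \<partial>unit_measure)"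
  define a where "a = dyadic_step (\<lambda>i. G i - \<mu>) m"
  have a_eq: "a w = dyadic_step G m w - \<mu>" for w by (simp add: a_def dyadic_step_def)
  have am [measurable]: "a \<in> borel_measurable borel" unfolding a_def by measurable
  \<comment> \<open>The minimiser of the final exponent
    \<open>- \<theta> \<eta> k + k m \<theta>^2 M^2\<close>.\<close>
  define \<theta> where "\<theta> = \<eta> / (2 * real m * M\<^sup>2)"
  have \<theta>: "\<theta> > 0" using m M \<eta> by (simp add: \<theta>_def)
  define J where "J = k div m + 1"
  \<comment> \<open>Convexity averages the \<open>m\<close> classes with weight
    \<open>1 / m\<close>, so each class enters its own exponential with the parameter
    \<open>m \<theta>\<close>.\<close>
  define L where "L = real m * \<theta>"
  have L: "L > 0" using \<theta> m by (simp add: L_def)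
  define S where "S = (\<lambda>w. \<Sum>j<k. a (2 ^ j * w))"
  have Sm [measurable]: "S \<in> borel_measurable borel" unfolding S_def by measurable
  define c where "c = (\<lambda>r i. if r + m * i < k then L else 0)"
  interpret X: interval_bounded_random_variable unit_measure "dyadic_step G m" "-M" M
  proof
    show "dyadic_step G m \<in> borel_measurable unit_measure" by measurable
    show "AE x in unit_measure. dyadic_step G m x \<in> {-M..M}"
      using G by (auto simp: dyadic_step_def abs_le_iff minus_le_iff)
  qed
  define E where "E = exp (L\<^sup>2 * M\<^sup>2 / 2)"
  have E: "E \<ge> 1" by (simp add: E_def)
  \<comment> \<open>Hoeffding's lemma for a centred variable in an interval of length
    \<open>2 M\<close>. A padded term has weight 0 and contributes 1, which is at most
    \<open>E\<close>.\<close>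
  have hoeff: "(\<integral>\<^sup>+w. ennreal (exp (c r i * a w)) \<partial>unit_measure) \<le> ennreal E" for r i
  proof (cases "r + m * i < k")
    case True
    have "(\<integral>\<^sup>+w. ennreal (exp (c r i * a w)) \<partial>unit_measure) \<le> ennreal (exp (L\<^sup>2 * (M - (- M))\<^sup>2 / 8))"
      using X.Hoeffdings_lemma_nn_integral[OF L] True by (simp add: c_def a_eq \<mu>_def)
    also have "L\<^sup>2 * (M - (- M))\<^sup>2 / 8 = L\<^sup>2 * M\<^sup>2 / 2" by (simp add: power2_eq_square)
    finally show ?thesis by (simp add: E_def)
  qed (use E in \<open>simp add: c_def unit_measure.emeasure_space_1[simplified]\<close>)
  have cls: "(\<integral>\<^sup>+w. ennreal (exp (\<Sum>i<J. c r i * a (2 ^ (r + m * i) * w))) \<partial>unit_measure) \<le> ennreal (E ^ J)" for r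
  proof -
    define H where "H = (\<lambda>v. ennreal (exp (\<Sum>i<J. c r i * a (2 ^ (m * i) * v))))"
    have [measurable]: "H \<in> borel_measurable borel" unfolding H_def by measurable
    have "a (2 ^ (r + m * i) * w) = a (2 ^ (m * i) * frac (2 ^ r * w))" for i w
      by (simp add: a_def dyadic_step_frac power_add mult_ac)
    then have "(\<integral>\<^sup>+w. ennreal (exp (\<Sum>i<J. c r i * a (2 ^ (r + m * i) * w))) \<partial>unit_measure)
       = (\<integral>\<^sup>+w. H (frac (real (2 ^ r) * w)) \<partial>unit_measure)"
      by (simp add: H_def)
    also have "\<dots> = (\<integral>\<^sup>+w. H w \<partial>unit_measure)" by (rule nn_integral_frac_invariant) auto
    also have "\<dots> = (\<Prod>i<J. \<integral>\<^sup>+w. ennreal (exp (c r i * a w)) \<partial>unit_measure)"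
      unfolding H_def a_def by (rule mgf_dyadic_step)
    also have "\<dots> \<le> (\<Prod>i<J. ennreal E)"
    proof (induction J)
      case (Suc J)
      then show ?case unfolding prod.lessThan_Suc by (intro mult_mono hoeff) auto
    qed simp
    also have "\<dots> = ennreal (E ^ J)" using E by (simp add: ennreal_power)
    finally show ?thesis .
  qed
  have conv: "exp (\<theta> * S w) \<le> (\<Sum>r<m. 1 / real m * exp (\<Sum>i<J. c r i * a (2 ^ (r + m * i) * w)))" for w
  proof -
    have "(\<Sum>r<m. (1 / real m) *\<^sub>R (\<Sum>i<J. c r i * a (2 ^ (r + m * i) * w)))
       = (\<Sum>r<m. \<Sum>i<J. \<theta> * (if r + m * i < k then a (2 ^ (r + m * i) * w) else 0))"
      using m by (simp add: sum_distrib_left c_def L_def if_distrib[of "\<lambda>x. x * _"] if_distrib[of "\<lambda>x. _ * x"] cong: if_cong)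
    also have "\<dots> = \<theta> * S w"
      unfolding S_def J_def sum_residue_classes[OF m(1), of "\<lambda>j. a (2 ^ j * w)" k] by (simp only: sum_distrib_left)
    finally have eq: "\<theta> * S w = (\<Sum>r<m. (1 / real m) *\<^sub>R (\<Sum>i<J. c r i * a (2 ^ (r + m * i) * w)))" ..
    have "convex_on UNIV (\<lambda>x::real. exp x)" using convex_on_exp[of 1] by simp
    then show ?thesis unfolding eq by (rule convex_on_sum[rotated 2]) (use m in auto)
  qed
  have mgf: "(\<integral>\<^sup>+w. ennreal (exp (\<theta> * S w)) \<partial>unit_measure) \<le> ennreal (E ^ J)"
  proof -
    have "(\<integral>\<^sup>+w. ennreal (exp (\<theta> * S w)) \<partial>unit_measure) \<le>
      (\<integral>\<^sup>+w. (\<Sum>r<m. ennreal (1 / real m) * ennreal (exp (\<Sum>i<J. c r i * a (2 ^ (r + m * i) * w)))) \<partial>unit_measure)"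
    proof (rule nn_integral_mono)
      fix w
      have "ennreal (exp (\<theta> * S w)) \<le> ennreal (\<Sum>r<m. 1 / real m * exp (\<Sum>i<J. c r i * a (2 ^ (r + m * i) * w)))"
        by (intro ennreal_leI conv)
      also have "\<dots> = (\<Sum>r<m. ennreal (1 / real m) * ennreal (exp (\<Sum>i<J. c r i * a (2 ^ (r + m * i) * w))))"
        by (simp add: ennreal_mult[symmetric] sum_ennreal)
      finally show "ennreal (exp (\<theta> * S w)) \<le> \<dots>" .
    qed
    also have "\<dots> = (\<Sum>r<m. ennreal (1 / real m) * (\<integral>\<^sup>+w. ennreal (exp (\<Sum>i<J. c r i * a (2 ^ (r + m * i) * w))) \<partial>unit_measure))"
      by (subst nn_integral_sum) (auto simp: nn_integral_cmult)
    also have "\<dots> \<le> (\<Sum>r<m. ennreal (1 / real m) * ennreal (E ^ J))"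
      by (intro sum_mono mult_left_mono cls) auto
    also have "\<dots> = ennreal (E ^ J)"
      using m E by (simp add: ennreal_of_nat_eq_real_of_nat ennreal_mult[symmetric])
    finally show ?thesis .
  qed
  have EJ: "E ^ J \<le> exp (real k * real m * \<theta>\<^sup>2 * M\<^sup>2)"
  proof -
    \<comment> \<open>Here \<open>m \<le> k\<close> enters: the \<open>k div m + 1\<close> blocks of
      length \<open>m\<close> cover at most \<open>k + m\<close> indices.\<close>
    have "J * m \<le> 2 * k" using m by (simp add: J_def) (metis add_mono div_times_less_eq_dividend mult.commute mult_2)
    then have Jm: "real J * real m \<le> 2 * real k" by (metis of_nat_le_iff of_nat_mult of_nat_numeral)
    have "E ^ J = exp (real J * (L\<^sup>2 * M\<^sup>2 / 2))" by (simp only: E_def exp_of_nat_mult)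
    also have "real J * (L\<^sup>2 * M\<^sup>2 / 2) = (real J * real m) * (real m * \<theta>\<^sup>2 * M\<^sup>2 / 2)"
      by (simp add: L_def power2_eq_square)
    also have "\<dots> \<le> (2 * real k) * (real m * \<theta>\<^sup>2 * M\<^sup>2 / 2)" using Jm by (intro mult_right_mono) auto
    also have "\<dots> = real k * real m * \<theta>\<^sup>2 * M\<^sup>2" by simp
    finally show ?thesis by simp
  qed
  let ?B = "{w. real k * (\<mu> + \<eta>) \<le> (\<Sum>j<k. dyadic_step G m (2 ^ j * w))}"
  have Beq: "?B = {w \<in> space unit_measure. 1 \<le> ennreal (exp (- \<theta> * \<eta> * real k)) * ennreal (exp (\<theta> * S w))}"
  proof -
    have "real k * (\<mu> + \<eta>) \<le> (\<Sum>j<k. dyadic_step G m (2 ^ j * w)) \<longleftrightarrow>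
       1 \<le> ennreal (exp (- \<theta> * \<eta> * real k)) * ennreal (exp (\<theta> * S w))" for w
    proof -
      have "S w = (\<Sum>j<k. dyadic_step G m (2 ^ j * w)) - real k * \<mu>"
        by (simp add: S_def a_eq sum_subtractf)
      moreover have "real k * (\<mu> + \<eta>) = real k * \<mu> + \<eta> * real k" by (simp add: algebra_simps)
      ultimately have "real k * (\<mu> + \<eta>) \<le> (\<Sum>j<k. dyadic_step G m (2 ^ j * w)) \<longleftrightarrow> \<eta> * real k \<le> S w"
        by (intro iffI) linarith+
      also have "\<dots> \<longleftrightarrow> \<theta> * (\<eta> * real k) \<le> \<theta> * S w" using \<theta> by simp
      also have "\<dots> \<longleftrightarrow> 0 \<le> - \<theta> * \<eta> * real k + \<theta> * S w" by (simp add: mult.assoc)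
      also have "\<dots> \<longleftrightarrow> 1 \<le> exp (- \<theta> * \<eta> * real k + \<theta> * S w)" by simp
      also have "\<dots> \<longleftrightarrow> 1 \<le> ennreal (exp (- \<theta> * \<eta> * real k + \<theta> * S w))" by simp
      also have "exp (- \<theta> * \<eta> * real k + \<theta> * S w) = exp (- \<theta> * \<eta> * real k) * exp (\<theta> * S w)" by (rule exp_add)
      finally show ?thesis by (simp add: ennreal_mult)
    qed
    then show ?thesis by simp
  qed
  have "emeasure unit_measure ?B \<le> ennreal (exp (- \<theta> * \<eta> * real k)) *
      (\<integral>\<^sup>+w. ennreal (exp (\<theta> * S w)) * indicator (space unit_measure) w \<partial>unit_measure)"
    unfolding Beq by (rule nn_integral_Markov_inequality) auto
  also have "\<dots> \<le> ennreal (exp (- \<theta> * \<eta> * real k)) * ennreal (exp (real k * real m * \<theta>\<^sup>2 * M\<^sup>2))"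
    using order_trans[OF mgf ennreal_leI[OF EJ]] by (intro mult_left_mono) auto
  also have "\<dots> = ennreal (exp (- \<theta> * \<eta> * real k + real k * real m * \<theta>\<^sup>2 * M\<^sup>2))"
    by (simp only: exp_add ennreal_mult' exp_ge_zero)
  also have "- \<theta> * \<eta> * real k + real k * real m * \<theta>\<^sup>2 * M\<^sup>2 = - (\<eta>\<^sup>2 * real k / (4 * real m * M\<^sup>2))"
    using m M by (simp add: \<theta>_def power2_eq_square field_simps)
  finally have "emeasure unit_measure ?B \<le> ennreal (exp (- (\<eta>\<^sup>2 * real k / (4 * real m * M\<^sup>2))))" .
  then have "measure unit_measure ?B \<le> exp (- (\<eta>\<^sup>2 * real k / (4 * real m * M\<^sup>2)))"
    by (simp add: measure_def enn2real_leI)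
  then show ?thesis by (simp only: \<mu>_def)
qed

section \<open>Averages along Stoltz sequences\<close>

text \<open>The supremum over a closed cell majorises the observable by a function of
  \<open>m\<close> digits. The two end cells get 0, since the observable may be unbounded there;
  orbits that meet them go into an exceptional set. Subtraction is on integers, so for
  \<open>m \<le> 1\<close> no cell remains.\<close>

definition cell_sup :: "(real \<Rightarrow> real) \<Rightarrow> nat \<Rightarrow> int \<Rightarrow> real" where
  "cell_sup F m i =
     (if 1 \<le> i \<and> i \<le> 2 ^ m - 2 then Sup (F ` {real_of_int i / 2 ^ m..(real_of_int i + 1) / 2 ^ m}) else 0)"

lemma integrable_unit_measure_powr:
  assumes e: "0 \<le> e" "e < 1"
  shows "integrable unit_measure (\<lambda>w. w powr - e)" "integrable unit_measure (\<lambda>w. (1 - w) powr - e)"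
proof -
  have "(\<lambda>w. w powr - e) absolutely_integrable_on {0..1}"
    using e by (intro nonnegative_absolutely_integrable_1 integrable_on_powr_from_0) auto
  then have "integrable lborel (\<lambda>w. indicator {0..1} w *\<^sub>R (w powr - e))"
    unfolding set_integrable_def by (subst (asm) integrable_completion) auto
  then have i: "integrable lborel (\<lambda>w. indicator {0..1::real} w * (w powr - e))" by simp
  have "integrable lborel (\<lambda>w. indicator {0..1::real} (1 + - 1 * w) * ((1 + - 1 * w) powr - e))"
    by (rule lborel_integrable_real_affine[OF i]) simp
  also have "(\<lambda>w. indicator {0..1::real} (1 + - 1 * w) * ((1 + - 1 * w) powr - e)) =
      (\<lambda>w. indicator {0..1::real} w * ((1 - w) powr - e))"
    by (auto simp: indicator_def fun_eq_iff)
  finally have i': "integrable lborel (\<lambda>w. indicator {0..1::real} w * ((1 - w) powr - e))" .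
  have *: "integrable unit_measure f" if "integrable lborel (\<lambda>w. indicator {0..1::real} w * f w)"
    and [measurable]: "f \<in> borel_measurable borel" for f :: "real \<Rightarrow> real"
  proof -
    have "integrable lborel (\<lambda>w. indicator {0..<1} w * (indicator {0..1::real} w * f w))"
      using integrable_real_mult_indicator[OF _ that(1), of "{0..<1}"] by (simp add: mult.commute)
    also have "(\<lambda>w. indicator {0..<1} w * (indicator {0..1::real} w * f w)) = (\<lambda>w. indicator {0..<1} w *\<^sub>R f w)"
      by (auto simp: indicator_def)
    finally have "integrable (density lborel (\<lambda>w. ennreal (indicator {0..<1} w))) f"
      by (subst integrable_density) auto
    then show ?thesis by (simp add: unit_measure_def ennreal_indicator)
  qed
  show "integrable unit_measure (\<lambda>w. w powr - e)" "integrable unit_measure (\<lambda>w. (1 - w) powr - e)"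
    using *[OF i] *[OF i'] by auto
qed

text \<open>With \<open>2 ^ p \<le> k < 2 ^ (p + 1)\<close> and \<open>l = 5 (p + 1)\<close>, the
  number \<open>2 ^ l\<close> lies between \<open>k ^ 5\<close> and \<open>32 k ^ 5\<close>. The
  second term is then at most \<open>2 / k ^ 4\<close>. The exponent in the first is at least of
  order \<open>k ^ (3/4) / log k\<close>, which makes that term at most \<open>1 / k ^ 4\<close>
  eventually.\<close>

lemma dyadic_level_exists:
  fixes c :: real
  assumes c: "c > 0"
  shows "\<exists>l. filterlim l at_top sequentially \<and>
    eventually (\<lambda>k. 0 < l k \<and> l k \<le> k \<and>
      exp (- (c * real k / (real (l k) * ((2 ^ l k) powr (1/40))\<^sup>2))) + 2 * real k / 2 ^ l k \<le> 3 / real k ^ 4) sequentially"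
proof -
  have "\<exists>p. 2 ^ p \<le> k \<and> k < 2 ^ (p + 1)" if "k \<ge> 1" for k :: nat
    using ex_power_ivl1[of 2 k] that by auto
  then obtain p :: "nat \<Rightarrow> nat" where p: "\<And>k::nat. k \<ge> 1 \<Longrightarrow> 2 ^ p k \<le> k \<and> k < 2 ^ (p k + 1)" by metis
  define l where "l = (\<lambda>k. 5 * (p k + 1))"
  have "filterlim l at_top sequentially"
    unfolding filterlim_at_top
  proof
    fix Z :: nat
    show "eventually (\<lambda>k. Z \<le> l k) sequentially"
    proof (rule eventually_mono[OF eventually_ge_at_top[of "2 ^ Z"]])
      fix k :: nat assume k: "2 ^ Z \<le> k"
      then have "k \<ge> 1" using order_trans[OF one_le_power k] by simp
      from p[OF this] k have "(2::nat) ^ Z < 2 ^ (p k + 1)" by (metis le_less_trans)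
      then have "Z < p k + 1" by (simp only: power_strict_increasing_iff)
      then show "Z \<le> l k" by (simp add: l_def)
    qed
  qed
  moreover have "eventually (\<lambda>x::real. exp (- (c * x / (5 * (log 2 x + 1) * (32 * x ^ 5) powr (1/20)))) \<le> 1 / x ^ 4) at_top"
    using c by real_asymp
  then have ev1: "eventually (\<lambda>k. exp (- (c * real k / (5 * (log 2 (real k) + 1) * (32 * real k ^ 5) powr (1/20)))) \<le> 1 / real k ^ 4) sequentially"
    by (rule eventually_compose_filterlim[OF _ filterlim_real_sequentially])
  have "eventually (\<lambda>x::real. 5 * (log 2 x + 1) \<le> x) at_top" by real_asymp
  then have ev2: "eventually (\<lambda>k. 5 * (log 2 (real k) + 1) \<le> real k) sequentially"
    by (rule eventually_compose_filterlim[OF _ filterlim_real_sequentially])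
  have "eventually (\<lambda>k. 0 < l k \<and> l k \<le> k \<and>
      exp (- (c * real k / (real (l k) * ((2 ^ l k) powr (1/40))\<^sup>2))) + 2 * real k / 2 ^ l k \<le> 3 / real k ^ 4) sequentially"
    using ev1 ev2 eventually_ge_at_top[of 1]
  proof eventually_elim
    case (elim k)
    define x where "x = real k"
    have x: "x \<ge> 1" using elim by (simp add: x_def)
    have "2 ^ p k \<le> k" "k < 2 ^ (p k + 1)" using p elim by auto
    then have "real (2 ^ p k) \<le> real k" "real k < real (2 ^ (p k + 1))" by (simp_all only: of_nat_le_iff of_nat_less_iff)
    then have px: "2 ^ p k \<le> x" "x \<le> 2 ^ (p k + 1)" by (simp_all add: x_def)
    have l2: "2 ^ l k = (2 ^ (p k + 1) :: real) ^ 5" unfolding l_def by (metis mult.commute power_mult)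
    have lo: "x ^ 5 \<le> 2 ^ l k" unfolding l2 using px x by (intro power_mono) auto
    have "(2 ^ (p k + 1) :: real) ^ 5 \<le> (2 * x) ^ 5" using px by (intro power_mono) auto
    then have hi: "2 ^ l k \<le> 32 * x ^ 5" unfolding l2 by (simp add: power_mult_distrib)
    have "real (p k) = log 2 (2 ^ p k)" by simp
    also have "\<dots> \<le> log 2 x" using px x by (subst log_le_cancel_iff) auto
    finally have lk: "real (l k) \<le> 5 * (log 2 x + 1)" by (simp add: l_def)
    have l0: "real (l k) > 0" by (simp add: l_def)
    have "((2 ^ l k) powr (1/40))\<^sup>2 = (2 ^ l k :: real) powr (1/20)"
      by (simp add: power2_eq_square powr_add[symmetric])
    also have "\<dots> \<le> (32 * x ^ 5) powr (1/20)" using hi by (intro powr_mono2) auto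
    finally have X: "((2 ^ l k) powr (1/40))\<^sup>2 \<le> (32 * x ^ 5) powr (1/20)" .
    have "c * x / (5 * (log 2 x + 1) * (32 * x ^ 5) powr (1/20)) \<le> c * x / (real (l k) * ((2 ^ l k) powr (1/40))\<^sup>2)"
      using c x lk l0 X by (intro divide_left_mono mult_mono mult_pos_pos) auto
    then have "exp (- (c * x / (real (l k) * ((2 ^ l k) powr (1/40))\<^sup>2))) \<le> 1 / x ^ 4"
      using elim(1) unfolding x_def[symmetric] by (smt (verit) exp_le_cancel_iff)
    moreover have "2 * x / 2 ^ l k \<le> 2 * x / x ^ 5" using lo x by (intro divide_left_mono) auto
    moreover have "2 * x / x ^ 5 = 2 / x ^ 4" using x by (simp add: eval_nat_numeral)
    moreover have "l k \<le> k" using lk elim(2) by (simp add: x_def)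
    ultimately show ?case using l0 unfolding x_def[symmetric] by (simp add: add_divide_distrib[symmetric])
  qed
  ultimately show ?thesis by blast
qed

lemma cell_bounds:
  fixes v :: real
  assumes i: "1 \<le> i" "i \<le> 2 ^ m - 2" and v: "v \<in> {real_of_int i / 2 ^ m..(real_of_int i + 1) / 2 ^ m}"
  shows "1 / 2 ^ m \<le> v" "1 / 2 ^ m \<le> 1 - v"
proof -
  have "1 / 2 ^ m \<le> real_of_int i / 2 ^ m" using i by (intro divide_right_mono) auto
  then show "1 / 2 ^ m \<le> v" using v by auto
  have "real_of_int i \<le> real_of_int (2 ^ m - 2)" using i(2) by (simp only: of_int_le_iff)
  then have "real_of_int i + 1 \<le> 2 ^ m - 1" by simp
  then have "(real_of_int i + 1) / 2 ^ m \<le> (2 ^ m - 1) / 2 ^ m" by (intro divide_right_mono) auto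
  also have "\<dots> = 1 - 1 / 2 ^ m" by (simp add: diff_divide_distrib)
  finally show "1 / 2 ^ m \<le> 1 - v" using v by auto
qed

lemma floor_cell:
  "w \<in> {of_int \<lfloor>2 ^ m * w\<rfloor> / 2 ^ m..(of_int \<lfloor>2 ^ m * w\<rfloor> + 1) / (2 ^ m :: real)}"
proof -
  have "of_int \<lfloor>2 ^ m * w\<rfloor> \<le> 2 ^ m * w" "2 ^ m * w \<le> of_int \<lfloor>2 ^ m * w\<rfloor> + 1" by linarith+
  then show ?thesis by (auto simp: field_simps)
qed

lemma floor_inner:
  assumes "1 / 2 ^ m \<le> w" "w < 1 - 1 / 2 ^ m"
  shows "1 \<le> \<lfloor>2 ^ m * w\<rfloor>" "\<lfloor>2 ^ m * w\<rfloor> \<le> 2 ^ m - 2"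
proof -
  have "1 \<le> 2 ^ m * w" "2 ^ m * w < 2 ^ m - 1" using assms by (simp_all add: field_simps)
  then have "2 ^ m * w < of_int (2 ^ m - 1)" by simp
  then have "\<lfloor>2 ^ m * w\<rfloor> < 2 ^ m - 1" by (simp only: floor_less_iff)
  then show "\<lfloor>2 ^ m * w\<rfloor> \<le> 2 ^ m - 2" by linarith
  show "1 \<le> \<lfloor>2 ^ m * w\<rfloor>" using \<open>1 \<le> 2 ^ m * w\<close> by (simp add: le_floor_iff)
qed

lemma AE_unit_measure_open: "AE w in unit_measure. 0 < w \<and> w < 1"
proof -
  have "AE w in lborel. w \<noteq> (0::real)" by (rule AE_lborel_singleton)
  then have "AE w in unit_measure. w \<noteq> 0" unfolding unit_measure_def by (subst AE_density) auto
  with AE_unit_measure show ?thesis by eventually_elim auto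
qed

section \<open>Digit majorants of an observable with power singularities at 0 and 1\<close>

context
  fixes F :: "real \<Rightarrow> real" and C e :: real
  assumes F [measurable]: "F \<in> borel_measurable borel"
    and contF: "continuous_on {0<..<1} F"
    and F_le: "\<And>w. 0 < w \<Longrightarrow> w < 1 \<Longrightarrow> \<bar>F w\<bar> \<le> C * (w powr - e + (1 - w) powr - e)"
    and C: "C > 0" and e: "0 < e" "e < 1"
begin

lemma abs_F_cell_le:
  assumes i: "1 \<le> i" "i \<le> 2 ^ m - 2" and v: "v \<in> {real_of_int i / 2 ^ m..(real_of_int i + 1) / 2 ^ m}"
  shows "\<bar>F v\<bar> \<le> 2 * C * (2 ^ m) powr e"
proof -
  note b = cell_bounds[OF assms]
  have p: "(0::real) < 1 / 2 ^ m" by simp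
  have "(1 / 2 ^ m :: real) powr - e = (2 ^ m) powr e" by (simp add: powr_divide powr_minus_divide)
  moreover have "v powr - e \<le> (1 / 2 ^ m) powr - e" "(1 - v) powr - e \<le> (1 / 2 ^ m) powr - e"
    using b e p by (intro powr_mono2'; simp)+
  ultimately have "v powr - e + (1 - v) powr - e \<le> 2 * (2 ^ m) powr e" by linarith
  then have "C * (v powr - e + (1 - v) powr - e) \<le> C * (2 * (2 ^ m) powr e)"
    using C by (intro mult_left_mono) auto
  moreover have "0 < v" "v < 1" using b p by linarith+
  ultimately show ?thesis using F_le[of v] by simp
qed

lemma abs_cell_sup_le: "\<bar>cell_sup F m i\<bar> \<le> 2 * C * (2 ^ m) powr e"
proof (cases "1 \<le> i \<and> i \<le> 2 ^ m - 2")
  case True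
  have "\<bar>Sup (F ` {real_of_int i / 2 ^ m..(real_of_int i + 1) / 2 ^ m})\<bar> \<le> 2 * C * (2 ^ m) powr e"
    using True by (intro cSup_abs_le) (auto simp: divide_right_mono intro!: abs_F_cell_le)
  then show ?thesis using True by (simp add: cell_sup_def)
qed (use C in \<open>auto simp: cell_sup_def\<close>)

lemma F_le_cell_sup:
  assumes "1 / 2 ^ m \<le> w" "w < 1 - 1 / 2 ^ m"
  shows "F w \<le> cell_sup F m \<lfloor>2 ^ m * w\<rfloor>"
proof -
  let ?i = "\<lfloor>2 ^ m * w\<rfloor>"
  note i = floor_inner[OF assms]
  have "bdd_above (F ` {of_int ?i / 2 ^ m..(of_int ?i + 1) / 2 ^ m})"
    by (intro bdd_aboveI[of _ "2 * C * (2 ^ m) powr e"]) (auto intro!: abs_le_D1[OF abs_F_cell_le[OF i]])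
  then have "F w \<le> Sup (F ` {of_int ?i / 2 ^ m..(of_int ?i + 1) / 2 ^ m})"
    using floor_cell[of w m] by (intro cSup_upper imageI)
  then show ?thesis using i by (simp add: cell_sup_def)
qed

text \<open>A bound independent of \<open>m\<close>, for dominated convergence. An inner cell is no
  wider than its distance from 0 and from 1, so the distances of two of its points to an end point
  differ by a factor of at most 2, and \<open>2 powr e \<le> 2\<close>.\<close>

lemma cell_sup_dominated:
  assumes w: "0 \<le> w" "w < 1"
  shows "\<bar>cell_sup F m \<lfloor>2 ^ m * w\<rfloor>\<bar> \<le> 2 * C * (w powr - e + (1 - w) powr - e)"
proof (cases "1 \<le> \<lfloor>2 ^ m * w\<rfloor> \<and> \<lfloor>2 ^ m * w\<rfloor> \<le> 2 ^ m - 2")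
  case True
  define i where "i = \<lfloor>2 ^ m * w\<rfloor>"
  have i: "1 \<le> i" "i \<le> 2 ^ m - 2" using True by (auto simp: i_def)
  note wc = floor_cell[of w m, folded i_def]
  note wb = cell_bounds[OF i wc]
  have p: "(0::real) < 1 / 2 ^ m" by simp
  have "\<bar>F v\<bar> \<le> 2 * C * (w powr - e + (1 - w) powr - e)"
    if v: "v \<in> {real_of_int i / 2 ^ m..(real_of_int i + 1) / 2 ^ m}" for v
  proof -
    note b = cell_bounds[OF i v]
    have "w - v \<le> 1 / 2 ^ m" "v - w \<le> 1 / 2 ^ m" using v wc by (auto simp: add_divide_distrib)
    then have "w - v \<le> v" "v - w \<le> 1 - v" using b by (blast intro: order_trans)+
    then have wv: "w / 2 \<le> v" "(1 - w) / 2 \<le> 1 - v" by (simp_all add: field_simps)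
    have w0: "0 < w" "0 < 1 - w" using wb p by linarith+
    have half: "(x / 2) powr - e \<le> 2 * x powr - e" if "x > 0" for x :: real
    proof -
      have "(x / 2) powr - e = 2 powr e * x powr - e" using that by (simp add: powr_divide powr_minus_divide)
      also have "2 powr e \<le> 2 powr (1::real)" using e by (intro powr_mono) auto
      then have "2 powr e * x powr - e \<le> 2 * x powr - e" by (intro mult_right_mono) auto
      finally show ?thesis .
    qed
    have "v powr - e \<le> (w / 2) powr - e" "(1 - v) powr - e \<le> ((1 - w) / 2) powr - e"
      using wv w0 e by (intro powr_mono2'; simp)+
    then have "v powr - e + (1 - v) powr - e \<le> 2 * (w powr - e + (1 - w) powr - e)"
      using half[of w] half[of "1 - w"] w0 by simp
    then have "C * (v powr - e + (1 - v) powr - e) \<le> C * (2 * (w powr - e + (1 - w) powr - e))"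
      using C by (intro mult_left_mono) auto
    also have "\<dots> = 2 * C * (w powr - e + (1 - w) powr - e)" by (simp only: mult_ac)
    finally have "C * (v powr - e + (1 - v) powr - e) \<le> 2 * C * (w powr - e + (1 - w) powr - e)" .
    moreover have "0 < v" "v < 1" using b p by linarith+
    ultimately show ?thesis using F_le[of v] by linarith
  qed
  then have "\<bar>Sup (F ` {real_of_int i / 2 ^ m..(real_of_int i + 1) / 2 ^ m})\<bar> \<le> 2 * C * (w powr - e + (1 - w) powr - e)"
    using i by (intro cSup_abs_le) (auto simp: divide_right_mono)
  then show ?thesis using i by (simp add: cell_sup_def i_def[symmetric])
qed (use C in \<open>auto simp: cell_sup_def\<close>)

text \<open>For large \<open>m\<close> the cell of \<open>w\<close> is an inner one and so short
  that continuity at \<open>w\<close> controls the supremum.\<close>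

lemma cell_sup_tendsto:
  assumes w: "0 < w" "w < 1"
  shows "(\<lambda>m. cell_sup F m \<lfloor>2 ^ m * w\<rfloor>) \<longlonglongrightarrow> F w"
proof (rule LIMSEQ_I)
  fix r :: real assume r: "r > 0"
  have "isCont F w" using contF w by (simp add: continuous_on_eq_continuous_at)
  then obtain \<delta> where \<delta>: "\<delta> > 0" "\<And>v. \<bar>v - w\<bar> < \<delta> \<Longrightarrow> \<bar>F v - F w\<bar> < r / 2"
    using r unfolding continuous_at_eps_delta dist_real_def by (meson half_gt_zero)
  have "(\<lambda>m. 1 / 2 ^ m :: real) \<longlonglongrightarrow> 0" by real_asymp
  moreover have "0 < min \<delta> (min w (1 - w))" using \<delta> w by simp
  ultimately have "eventually (\<lambda>m. 1 / 2 ^ m < min \<delta> (min w (1 - w))) sequentially"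
    by (rule order_tendstoD)
  then obtain m0 where m0: "\<And>m. m \<ge> m0 \<Longrightarrow> 1 / 2 ^ m < min \<delta> (min w (1 - w))"
    by (auto simp: eventually_sequentially)
  show "\<exists>m0. \<forall>m\<ge>m0. norm (cell_sup F m \<lfloor>2 ^ m * w\<rfloor> - F w) < r"
  proof (intro exI[of _ m0] allI impI)
    fix m assume "m \<ge> m0"
    from m0[OF this] have sm: "1 / 2 ^ m < \<delta>" "1 / 2 ^ m \<le> w" "w < 1 - 1 / 2 ^ m" by auto
    define i where "i = \<lfloor>2 ^ m * w\<rfloor>"
    note i = floor_inner[OF sm(2,3), folded i_def]
    note wc = floor_cell[of w m, folded i_def]
    have "\<bar>Sup (F ` {real_of_int i / 2 ^ m..(real_of_int i + 1) / 2 ^ m}) - F w\<bar> \<le> r / 2"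
    proof (intro cSup_asclose ballI)
      show "F ` {real_of_int i / 2 ^ m..(real_of_int i + 1) / 2 ^ m} \<noteq> {}" using wc by blast
      fix y assume "y \<in> F ` {real_of_int i / 2 ^ m..(real_of_int i + 1) / 2 ^ m}"
      then obtain v where v: "v \<in> {real_of_int i / 2 ^ m..(real_of_int i + 1) / 2 ^ m}" "y = F v" by blast
      have "\<bar>v - w\<bar> \<le> 1 / 2 ^ m" using v wc by (auto simp: add_divide_distrib abs_le_iff)
      then show "\<bar>y - F w\<bar> \<le> r / 2" using \<delta>(2)[of v] sm v by simp
    qed
    then show "norm (cell_sup F m \<lfloor>2 ^ m * w\<rfloor> - F w) < r"
      using i r by (simp add: cell_sup_def i_def[symmetric])
  qed
qed

lemma integrable_dominator: "integrable unit_measure (\<lambda>w. 2 * C * (w powr - e + (1 - w) powr - e))"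
  using integrable_unit_measure_powr[of e] e by simp

text \<open>The price of replacing \<open>F\<close> by its majorant: for large \<open>m\<close> the
  means differ by less than any given \<open>\<eta>\<close>, which supplies the hypothesis
  \<open>mean\<close> of the next lemma.\<close>

lemma integral_dyadic_step_cell_sup:
  "(\<lambda>m. \<integral>w. dyadic_step (cell_sup F m) m w \<partial>unit_measure) \<longlonglongrightarrow> (\<integral>w. F w \<partial>unit_measure)"
proof (rule integral_dominated_convergence[where w = "\<lambda>w. 2 * C * (w powr - e + (1 - w) powr - e)"])
  show "AE w in unit_measure. (\<lambda>m. dyadic_step (cell_sup F m) m w) \<longlonglongrightarrow> F w"
    using AE_unit_measure_open
    by eventually_elim (use cell_sup_tendsto in \<open>simp add: dyadic_step_def frac_eq[THEN iffD2]\<close>)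
  show "AE w in unit_measure. norm (dyadic_step (cell_sup F m) m w) \<le> 2 * C * (w powr - e + (1 - w) powr - e)" for m
    using AE_unit_measure
    by eventually_elim (use cell_sup_dominated in \<open>simp add: dyadic_step_def frac_eq[THEN iffD2]\<close>)
qed (use integrable_dominator in auto)

text \<open>Either the orbit meets an end cell, or \<open>F\<close> is below its majorant at all
  \<open>k\<close> steps and the Chernoff event occurs. Both events are pulled back by
  measure-preserving maps, so the bound does not depend on \<open>n\<close>. One
  \<open>\<eta>\<close> pays for the mean of the majorant, the other for the deviation.\<close>

lemma measure_large_average:
  assumes m: "0 < m" "m \<le> k" and \<eta>: "\<eta> > 0"
    and mean: "(\<integral>w. dyadic_step (cell_sup F m) m w \<partial>unit_measure) \<le> (\<integral>w. F w \<partial>unit_measure) + \<eta>"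
  shows "measure unit_measure
     {w. real k * ((\<integral>w. F w \<partial>unit_measure) + 2 * \<eta>) < (\<Sum>j=1..k. F (frac (2 ^ (n + j) * w)))}
     \<le> exp (- (\<eta>\<^sup>2 * real k / (4 * real m * (2 * C * (2 ^ m) powr e)\<^sup>2))) + 2 * real k / 2 ^ m"
proof -
  let ?g = "dyadic_step (cell_sup F m) m"
  let ?L = "\<integral>w. F w \<partial>unit_measure"
  let ?B = "{w. real k * (?L + 2 * \<eta>) < (\<Sum>j=1..k. F (frac (2 ^ (n + j) * w)))}"
  define CH where "CH = {w. real k * ((\<integral>w. ?g w \<partial>unit_measure) + \<eta>) \<le> (\<Sum>j<k. ?g (2 ^ j * w))}"
  \<comment> \<open>The two end cells, together with points outside the unit interval, which form a
    null set.\<close>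
  define E where "E = ({..<1 / 2 ^ m} \<union> {1 - 1 / 2 ^ m..} :: real set)"
  have [measurable]: "CH \<in> sets borel" "E \<in> sets borel" unfolding CH_def E_def by measurable
  have mE: "measure unit_measure E \<le> 2 / 2 ^ m"
  proof -
    have "emeasure unit_measure E = emeasure lborel (E \<inter> {0..<1})" by (rule emeasure_unit_measure) simp
    also have "\<dots> \<le> emeasure lborel ({0..1 / 2 ^ m} \<union> {1 - 1 / 2 ^ m..1::real})"
      by (intro emeasure_mono) (auto simp: E_def)
    also have "\<dots> \<le> emeasure lborel {0..1 / 2 ^ m :: real} + emeasure lborel {1 - 1 / 2 ^ m..1::real}"
      by (rule emeasure_subadditive) auto
    also have "\<dots> = ennreal (2 / 2 ^ m)" by (simp add: ennreal_plus[symmetric] del: ennreal_plus)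
    finally show ?thesis by (simp add: measure_def enn2real_leI)
  qed
  have sub: "?B \<subseteq> {w. frac (real (2 ^ (n + 1)) * w) \<in> CH} \<union> (\<Union>j\<in>{1..k}. {w. frac (real (2 ^ (n + j)) * w) \<in> E})"
  proof
    fix w assume w: "w \<in> ?B"
    show "w \<in> {w. frac (real (2 ^ (n + 1)) * w) \<in> CH} \<union> (\<Union>j\<in>{1..k}. {w. frac (real (2 ^ (n + j)) * w) \<in> E})"
    proof (cases "\<exists>j\<in>{1..k}. frac (2 ^ (n + j) * w) \<in> E")
      case False
      have "(\<Sum>j=1..k. F (frac (2 ^ (n + j) * w))) \<le> (\<Sum>j=1..k. ?g (2 ^ (n + j) * w))"
        using False by (intro sum_mono) (auto simp: dyadic_step_def E_def not_less not_le intro!: F_le_cell_sup)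
      \<comment> \<open>The averages start at \<open>j = 1\<close> and the Chernoff sum at 0, hence
        the pull-back by \<open>2 ^ (n + 1)\<close>.\<close>
      also have "\<dots> = (\<Sum>j<k. ?g (2 ^ j * frac (2 ^ (n + 1) * w)))"
        by (simp add: sum.atLeast1_atMost_eq dyadic_step_frac power_add mult_ac)
      finally have "real k * (?L + 2 * \<eta>) \<le> (\<Sum>j<k. ?g (2 ^ j * frac (2 ^ (n + 1) * w)))" using w by simp
      moreover have "real k * ((\<integral>w. ?g w \<partial>unit_measure) + \<eta>) \<le> real k * (?L + 2 * \<eta>)"
        using mean by (intro mult_left_mono) auto
      ultimately have "frac (real (2 ^ (n + 1)) * w) \<in> CH" by (simp add: CH_def)
      then show ?thesis by blast
    qed auto
  qed
  have "measure unit_measure ?B \<le> measure unit_measure ({w. frac (real (2 ^ (n + 1)) * w) \<in> CH} \<union>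
       (\<Union>j\<in>{1..k}. {w. frac (real (2 ^ (n + j)) * w) \<in> E}))"
    by (rule unit_measure.finite_measure_mono[OF sub]) measurable
  also have "\<dots> \<le> measure unit_measure {w. frac (real (2 ^ (n + 1)) * w) \<in> CH} +
       measure unit_measure (\<Union>j\<in>{1..k}. {w. frac (real (2 ^ (n + j)) * w) \<in> E})"
    by (rule measure_Un_le) measurable
  also have "\<dots> \<le> measure unit_measure {w. frac (real (2 ^ (n + 1)) * w) \<in> CH} +
       (\<Sum>j=1..k. measure unit_measure {w. frac (real (2 ^ (n + j)) * w) \<in> E})"
    by (intro add_left_mono measure_UNION_le) auto
  also have "\<dots> = measure unit_measure CH + real k * measure unit_measure E"
    by (simp only: measure_frac_invariant[OF \<open>CH \<in> _\<close>] measure_frac_invariant[OF \<open>E \<in> _\<close>] zero_less_power zero_less_numeral) simp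
  also have "\<dots> \<le> exp (- (\<eta>\<^sup>2 * real k / (4 * real m * (2 * C * (2 ^ m) powr e)\<^sup>2))) + real k * (2 / 2 ^ m)"
    unfolding CH_def using C
    by (intro add_mono mult_left_mono mE chernoff_dyadic_step abs_cell_sup_le m \<eta>) auto
  finally show ?thesis by (simp add: mult_ac)
qed

text \<open>The union of the bad sets over \<open>N k\<close> has measure at most
  \<open>6 A / k ^ 3\<close> for large \<open>k\<close>, which is summable. The conclusion is a
  limit in \<open>k\<close>, uniform over \<open>N k\<close>, and therefore applies along any
  sequence of pairs whose second entry tends to infinity.\<close>

lemma AE_averages_le:
  fixes N :: "nat \<Rightarrow> nat set" and A \<eta> :: real
  assumes e_def: "e = 1/40" and fin: "\<And>k. finite (N k)" and card: "\<And>k. real (card (N k)) \<le> A * (real k + 1)"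
    and A: "A > 0" and \<eta>: "\<eta> > 0"
  shows "AE w in unit_measure. eventually (\<lambda>k. \<forall>n\<in>N k.
     (\<Sum>j=1..k. F (frac (2 ^ (n + j) * w))) \<le> real k * ((\<integral>w. F w \<partial>unit_measure) + 2 * \<eta>)) sequentially"
proof -
  let ?L = "\<integral>w. F w \<partial>unit_measure"
  define B where "B = (\<lambda>n k. {w. real k * (?L + 2 * \<eta>) < (\<Sum>j=1..k. F (frac (2 ^ (n + j) * w)))})"
  have [measurable]: "B n k \<in> sets borel" for n k unfolding B_def by measurable
  define U where "U = (\<lambda>k. \<Union>n\<in>N k. B n k)"
  have [measurable]: "U k \<in> sets borel" for k unfolding U_def using fin by (intro sets.finite_UN) auto
  \<comment> \<open>Combines the 4 of the Chernoff bound with the square of the factor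
    \<open>2 C\<close> in the size of the majorant.\<close>
  define c where "c = \<eta>\<^sup>2 / (16 * C\<^sup>2)"
  have c: "c > 0" using \<eta> C by (simp add: c_def)
  obtain l where l: "filterlim l at_top sequentially"
    "eventually (\<lambda>k. 0 < l k \<and> l k \<le> k \<and>
      exp (- (c * real k / (real (l k) * ((2 ^ l k) powr (1/40))\<^sup>2))) + 2 * real k / 2 ^ l k \<le> 3 / real k ^ 4) sequentially"
    using dyadic_level_exists[OF c] by blast
  have "((\<lambda>k. \<integral>w. dyadic_step (cell_sup F (l k)) (l k) w \<partial>unit_measure) \<longlongrightarrow> ?L) sequentially"
    by (rule filterlim_compose[OF integral_dyadic_step_cell_sup l(1)])
  then have "eventually (\<lambda>k. (\<integral>w. dyadic_step (cell_sup F (l k)) (l k) w \<partial>unit_measure) < ?L + \<eta>) sequentially"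
    by (rule order_tendstoD) (use \<eta> in simp)
  then have ev: "eventually (\<lambda>k. norm (measure unit_measure (U k)) \<le> 6 * A * (1 / real k ^ 3)) sequentially"
    using l(2) eventually_ge_at_top[of 1]
  proof eventually_elim
    case (elim k)
    have B: "measure unit_measure (B n k) \<le> 3 / real k ^ 4" for n
    proof -
      have "measure unit_measure (B n k) \<le>
         exp (- (\<eta>\<^sup>2 * real k / (4 * real (l k) * (2 * C * (2 ^ l k) powr e)\<^sup>2))) + 2 * real k / 2 ^ l k"
        unfolding B_def by (rule measure_large_average) (use elim \<eta> in auto)
      also have "\<eta>\<^sup>2 * real k / (4 * real (l k) * (2 * C * (2 ^ l k) powr e)\<^sup>2) =
         c * real k / (real (l k) * ((2 ^ l k) powr (1/40))\<^sup>2)"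
        by (simp add: c_def e_def power_mult_distrib)
      also have "exp (- (c * real k / (real (l k) * ((2 ^ l k) powr (1/40))\<^sup>2))) + 2 * real k / 2 ^ l k \<le> 3 / real k ^ 4"
        using elim by simp
      finally show ?thesis .
    qed
    have "measure unit_measure (U k) \<le> (\<Sum>n\<in>N k. measure unit_measure (B n k))"
      unfolding U_def by (rule measure_UNION_le[OF fin]) simp
    also have "\<dots> \<le> (\<Sum>n\<in>N k. 3 / real k ^ 4)" by (intro sum_mono B)
    also have "\<dots> = real (card (N k)) * (3 / real k ^ 4)" by simp
    also have "\<dots> \<le> (A * (2 * real k)) * (3 / real k ^ 4)"
    proof (intro mult_right_mono order_trans[OF card])
      show "A * (real k + 1) \<le> A * (2 * real k)" using A elim by (intro mult_left_mono) auto
    qed auto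
    also have "\<dots> = 6 * A * (1 / real k ^ 3)" using elim by (simp add: eval_nat_numeral)
    finally show ?case by simp
  qed
  have "summable (\<lambda>k. measure unit_measure (U k))"
  proof (rule summable_comparison_test_ev[OF ev])
    have "summable (\<lambda>k. inverse (real k ^ 3))" by (rule inverse_power_summable) simp
    then show "summable (\<lambda>k. 6 * A * (1 / real k ^ 3))" by (intro summable_mult) (simp add: divide_inverse)
  qed
  then have "AE w in unit_measure. eventually (\<lambda>k. w \<in> space unit_measure - U k) sequentially"
    by (intro borel_cantelli_AE1) (auto simp: unit_measure.emeasure_eq_measure)
  then show ?thesis
    by eventually_elim (auto simp: U_def B_def not_less elim!: eventually_mono)
qed

end

text \<open>The one-sided estimate is applied to \<open>F\<close> and to \<open>- F\<close>, with
  tolerances built from \<open>1 / (i + 1)\<close>, so that only countably many null sets are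
  joined.\<close>

lemma AE_averages_tendsto:
  fixes F :: "real \<Rightarrow> real" and N :: "nat \<Rightarrow> nat set" and n\<^sub>q k\<^sub>q :: "nat \<Rightarrow> nat" and A C :: real
  assumes F: "F \<in> borel_measurable borel" and contF: "continuous_on {0<..<1} F"
    and F_le: "\<And>w. 0 < w \<Longrightarrow> w < 1 \<Longrightarrow> \<bar>F w\<bar> \<le> C * (w powr - (1/40) + (1 - w) powr - (1/40))"
    and C: "C > 0"
    and fin: "\<And>k. finite (N k)" and card: "\<And>k. real (card (N k)) \<le> A * (real k + 1)" and A: "A > 0"
    and N: "eventually (\<lambda>q. n\<^sub>q q \<in> N (k\<^sub>q q)) sequentially" and k: "filterlim k\<^sub>q at_top sequentially"
  shows "AE w in unit_measure. (\<lambda>q. 1 / real (k\<^sub>q q) * (\<Sum>j=1..k\<^sub>q q. F (frac (2 ^ (n\<^sub>q q + j) * w))))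
     \<longlonglongrightarrow> (\<integral>w. F w \<partial>unit_measure)"
proof -
  let ?L = "\<integral>w. F w \<partial>unit_measure"
  let ?\<eta> = "\<lambda>i::nat. 1 / real (Suc i)"
  have up: "AE w in unit_measure. \<forall>i. eventually (\<lambda>k. \<forall>n\<in>N k.
     (\<Sum>j=1..k. F (frac (2 ^ (n + j) * w))) \<le> real k * (?L + 2 * ?\<eta> i)) sequentially"
    unfolding AE_all_countable
    by (intro allI AE_averages_le[OF F contF F_le C _ _ refl fin card A]) auto
  have lo: "AE w in unit_measure. \<forall>i. eventually (\<lambda>k. \<forall>n\<in>N k.
     (\<Sum>j=1..k. - F (frac (2 ^ (n + j) * w))) \<le> real k * ((\<integral>w. - F w \<partial>unit_measure) + 2 * ?\<eta> i)) sequentially"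
    unfolding AE_all_countable
    by (intro allI AE_averages_le[where F = "\<lambda>w. - F w", OF _ _ _ C _ _ refl fin card A] continuous_intros contF
          borel_measurable_uminus F) (use F_le in auto)
  from up lo show ?thesis
  proof eventually_elim
    case (elim w)
    let ?S = "\<lambda>q. \<Sum>j=1..k\<^sub>q q. F (frac (2 ^ (n\<^sub>q q + j) * w))"
    show ?case
    proof (rule LIMSEQ_I)
      fix r :: real assume r: "r > 0"
      then obtain i where i: "2 * ?\<eta> i < r"
        using reals_Archimedean[of "r / 2"] by (auto simp: inverse_eq_divide)
      have "eventually (\<lambda>q. 1 \<le> k\<^sub>q q) sequentially" using k by (simp add: filterlim_at_top)
      then have "eventually (\<lambda>q. norm (1 / real (k\<^sub>q q) * ?S q - ?L) < r) sequentially"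
        using eventually_compose_filterlim[OF elim(1)[rule_format, of i] k]
          eventually_compose_filterlim[OF elim(2)[rule_format, of i] k] N
      proof eventually_elim
        case (elim q)
        have k0: "real (k\<^sub>q q) > 0" using elim(1) by simp
        have "?S q \<le> real (k\<^sub>q q) * (?L + 2 * ?\<eta> i)" using elim(2,4) by blast
        moreover have "- ?S q \<le> real (k\<^sub>q q) * (- ?L + 2 * ?\<eta> i)"
          using elim(3,4) by (simp add: sum_negf)
        ultimately have "?S q / real (k\<^sub>q q) \<le> ?L + 2 * ?\<eta> i" "- ?S q / real (k\<^sub>q q) \<le> - ?L + 2 * ?\<eta> i"
          using k0 by (simp_all only: pos_divide_le_eq mult.commute)
        then show ?case using i by simp
      qed
      then show "\<exists>q0. \<forall>q\<ge>q0. norm (1 / real (k\<^sub>q q) * ?S q - ?L) < r"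
        by (simp add: eventually_sequentially)
    qed
  qed
qed

text \<open>A point of height \<open>k \<ge> h0\<close> lies in the section at height
  \<open>k + 1\<close> of its own cone, because \<open>0 < a0\<close>; hence at most
  \<open>A (k + 1)\<close> points have height \<open>k\<close>. The choice \<open>t = q\<close>
  gives \<open>k\<^sub>q q \<ge> h q\<close>, so the heights tend to infinity and eventually pass
  \<open>h0\<close>.\<close>

lemma stoltz_index_sets:
  assumes "stoltz n\<^sub>q k\<^sub>q"
  obtains N :: "nat \<Rightarrow> nat set" and A :: real where
    "\<And>k. finite (N k)" "\<And>k. real (card (N k)) \<le> A * (real k + 1)" "A > 0"
    "eventually (\<lambda>q. n\<^sub>q q \<in> N (k\<^sub>q q)) sequentially" "filterlim k\<^sub>q at_top sequentially"
proof -
  from assms obtain Z h h0 a0 A where h: "filterlim h at_top sequentially"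
    and up: "\<forall>t\<ge>1. \<forall>l\<ge>t. (int (n\<^sub>q l), k\<^sub>q l) \<in> stoltz_upper Z (h t)"
    and a0: "a0 > 0" and A: "A > 0"
    and sec': "\<forall>m>0. finite (stoltz_section Z h0 a0 m) \<and> real (card (stoltz_section Z h0 a0 m)) \<le> A * real m"
    unfolding stoltz_def by (elim exE conjE) (rule that)
  have sec: "finite (stoltz_section Z h0 a0 m)" "real (card (stoltz_section Z h0 a0 m)) \<le> A * real m"
    if "m > 0" for m
    using sec' that by auto
  define N where "N = (\<lambda>k. {n. (int n, k) \<in> stoltz_upper Z h0})"
  have sub: "int ` N k \<subseteq> stoltz_section Z h0 a0 (Suc k)" for k
    using a0 by (force simp: N_def stoltz_section_def stoltz_cone_def)
  have fin: "finite (N k)" for k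
    using finite_subset[OF sub sec(1)] by (simp add: finite_image_iff)
  have card: "real (card (N k)) \<le> A * (real k + 1)" for k
  proof -
    have "card (N k) = card (int ` N k)" by (simp add: card_image)
    also have "\<dots> \<le> card (stoltz_section Z h0 a0 (Suc k))" by (intro card_mono sub sec) simp
    finally have "real (card (N k)) \<le> real (card (stoltz_section Z h0 a0 (Suc k)))" by simp
    also have "\<dots> \<le> A * real (Suc k)" by (rule sec) simp
    finally show ?thesis by (simp add: add.commute)
  qed
  have hk: "real (k\<^sub>q q) \<ge> h q" and Z: "(int (n\<^sub>q q), k\<^sub>q q) \<in> Z" if "q \<ge> 1" for q
    using up[rule_format, OF that order_refl] by (auto simp: stoltz_upper_def)
  have k: "filterlim k\<^sub>q at_top sequentially"
    unfolding filterlim_at_top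
  proof
    fix M :: nat
    have "eventually (\<lambda>q. real M \<le> h q) sequentially" using h by (simp add: filterlim_at_top)
    then show "eventually (\<lambda>q. M \<le> k\<^sub>q q) sequentially"
      using eventually_ge_at_top[of 1] by eventually_elim (use hk in force)
  qed
  have "eventually (\<lambda>q. h0 \<le> h q) sequentially" using h by (simp add: filterlim_at_top)
  then have "eventually (\<lambda>q. n\<^sub>q q \<in> N (k\<^sub>q q)) sequentially"
    using eventually_ge_at_top[of 1]
  proof eventually_elim
    case (elim q)
    then show ?case using hk[of q] Z[of q] by (simp add: N_def stoltz_upper_def)
  qed
  with fin card A k show thesis by (intro that)
qed




section \<open>The Boole map as angle doubling\<close>

text \<open>On the open unit interval this is the quantile function of the Cauchy law with location
  \<open>\<beta>\<close> and scale \<open>\<alpha>\<close>, since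
  \<open>- cot (pi w) = tan (pi w - pi / 2)\<close>.\<close>

definition boole_coord :: "real \<Rightarrow> real \<Rightarrow> real \<Rightarrow> real" where
  "boole_coord \<alpha> \<beta> w = \<beta> - \<alpha> * cot (pi * w)"

text \<open>No side conditions: if \<open>sin t\<close> or \<open>cos t\<close> vanishes, so does
  \<open>sin (2 t)\<close>, and division by zero makes both sides 0.\<close>

lemma cot_double_real: "cot (2 * t) = (if cot t = 0 then 0 else ((cot t)\<^sup>2 - 1) / (2 * cot (t::real)))"
proof (cases "sin t = 0 \<or> cos t = 0")
  case False
  then have "cot t \<noteq> 0" by (simp add: cot_def)
  moreover have "cot (2 * t) = ((cot t)\<^sup>2 - 1) / (2 * cot t)"
  proof -
    have "cot (2 * t) = ((cos t)\<^sup>2 - (sin t)\<^sup>2) / (2 * sin t * cos t)"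
      by (simp only: cot_def sin_double cos_double)
    also have "\<dots> = ((cot t)\<^sup>2 - 1) / (2 * cot t)"
      using False by (simp add: cot_def power2_eq_square divide_simps)
    finally show ?thesis .
  qed
  ultimately show ?thesis by simp
qed (auto simp: cot_def sin_double)

text \<open>The junk values agree: where \<open>cot\<close> has a pole or a zero, both sides are \<open>\<beta>\<close>.\<close>

lemma boole_map_coord:
  assumes "\<alpha> > 0"
  shows "boole_map \<alpha> \<beta> (boole_coord \<alpha> \<beta> w) = boole_coord \<alpha> \<beta> (2 * w)"
proof (cases "cot (pi * w) = 0")
  case True
  then show ?thesis
    using cot_double_real[of "pi * w"] by (simp add: boole_map_def boole_coord_def mult_ac)
next
  case False
  have "cot (pi * (2 * w)) = ((cot (pi * w))\<^sup>2 - 1) / (2 * cot (pi * w))"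
    using cot_double_real[of "pi * w"] False by (simp add: mult_ac)
  moreover have "\<alpha> / 2 * ((\<beta> - \<alpha> * c + \<beta>) / \<alpha> - \<alpha> / (\<beta> - \<alpha> * c - \<beta>)) = \<beta> - \<alpha> * ((c\<^sup>2 - 1) / (2 * c))"
    if "c \<noteq> 0" for c
    using assms that by (simp add: power2_eq_square field_simps)
  ultimately show ?thesis
    using assms False by (simp add: boole_map_def boole_coord_def)
qed

text \<open>Since the junk values agree, the conjugacy iterates for every \<open>w\<close>, with no
  exceptional set of orbits that hit \<open>\<beta>\<close>.\<close>

lemma boole_map_iterate_coord:
  assumes "\<alpha> > 0"
  shows "(boole_map \<alpha> \<beta> ^^ j) (boole_coord \<alpha> \<beta> w) = boole_coord \<alpha> \<beta> (2 ^ j * w)"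
  by (induction j) (simp_all add: boole_map_coord[OF assms] mult_ac)

lemma boole_coord_frac: "boole_coord \<alpha> \<beta> (frac w) = boole_coord \<alpha> \<beta> w"
proof -
  have "tan (pi * w) = tan (pi * frac w + of_int \<lfloor>w\<rfloor> * pi)"
    by (simp add: frac_def algebra_simps)
  then show ?thesis by (simp add: boole_coord_def cot_altdef tan_periodic_int)
qed

lemma cot_eq_tan: "cot (pi * w) = - tan (pi * w - pi / 2)"
  using tan_cot'[of "pi * w"] tan_minus[of "pi * w - pi / 2"] by simp

lemma boole_coord_ge_iff:
  assumes \<alpha>: "\<alpha> > 0" and w: "0 < w" "w < 1"
  shows "x \<le> boole_coord \<alpha> \<beta> w \<longleftrightarrow> 1/2 + arctan ((x - \<beta>) / \<alpha>) / pi \<le> w"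
proof -
  define t where "t = pi * w - pi / 2"
  have "pi * w < pi * 1" using w by (intro mult_strict_left_mono) auto
  then have t: "- (pi / 2) < t" "t < pi / 2" using w by (auto simp: t_def)
  have "x \<le> boole_coord \<alpha> \<beta> w \<longleftrightarrow> (x - \<beta>) / \<alpha> \<le> tan t"
    using \<alpha> by (simp add: boole_coord_def cot_eq_tan t_def[symmetric] pos_divide_le_eq algebra_simps)
  also have "\<dots> \<longleftrightarrow> arctan ((x - \<beta>) / \<alpha>) \<le> t"
    using arctan_le_iff[of "(x - \<beta>) / \<alpha>" "tan t"] arctan_tan[OF t] by simp
  also have "\<dots> \<longleftrightarrow> 1/2 + arctan ((x - \<beta>) / \<alpha>) / pi \<le> w"
    by (simp add: t_def field_simps)
  finally show ?thesis .
qed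

lemma borel_measurable_boole_coord [measurable]: "boole_coord \<alpha> \<beta> \<in> borel_measurable borel"
  unfolding boole_coord_def[abs_def] cot_def[abs_def] by measurable

text \<open>It suffices to compare closed half lines. Monotonicity of the coordinate turns one into
  an interval of length \<open>1 - u\<close>, and the arctangent, a primitive of the Cauchy density,
  gives the same value on the other side.\<close>

lemma distr_boole_coord:
  assumes \<alpha>: "\<alpha> > 0"
  shows "distr unit_measure borel (boole_coord \<alpha> \<beta>) = boole_measure \<alpha> \<beta>"
proof (rule measure_eqI_generator_eq[where E = "range (\<lambda>x::real. {x..})" and \<Omega> = UNIV and A = "\<lambda>n. {- real n..}"])
  show "Int_stable (range (\<lambda>x::real. {x..}))" 
  proof (rule Int_stableI_image)
    fix x y :: real
    have "{x..} \<inter> {y..} = {max x y..}" by auto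
    then show "\<exists>k\<in>UNIV. {x..} \<inter> {y..} = {k..}" by blast
  qed
  show "sets (distr unit_measure borel (boole_coord \<alpha> \<beta>)) = sigma_sets UNIV (range (\<lambda>x::real. {x..}))"
    "sets (boole_measure \<alpha> \<beta>) = sigma_sets UNIV (range (\<lambda>x::real. {x..}))"
    by (simp_all add: boole_measure_def borel_Ici)
  show "(\<Union>n. {- real n..}) = UNIV"
    by (auto simp: minus_le_iff intro: real_arch_simple)
  show "emeasure (distr unit_measure borel (boole_coord \<alpha> \<beta>)) {- real n..} \<noteq> \<infinity>" for n
    by (simp add: emeasure_distr unit_measure.emeasure_eq_measure)
  fix S :: "real set" assume "S \<in> range (\<lambda>x::real. {x..})"
  then obtain x where S: "S = {x..}" by blast
  define u where "u = 1/2 + arctan ((x - \<beta>) / \<alpha>) / pi"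
  have u: "0 < u" "u < 1" using arctan_bounded[of "(x - \<beta>) / \<alpha>"] by (simp_all add: u_def field_simps)
  have "emeasure (distr unit_measure borel (boole_coord \<alpha> \<beta>)) S = emeasure unit_measure {w. x \<le> boole_coord \<alpha> \<beta> w}"
    by (simp add: S emeasure_distr vimage_def)
  also have "\<dots> = emeasure unit_measure {u..<1}"
  proof (rule emeasure_eq_AE)
    show "AE w in unit_measure. w \<in> {w. x \<le> boole_coord \<alpha> \<beta> w} \<longleftrightarrow> w \<in> {u..<1}"
      using AE_unit_measure_open
      by eventually_elim (use boole_coord_ge_iff[OF \<alpha>] in \<open>simp add: u_def\<close>)
  qed measurable
  also have "\<dots> = ennreal (1 - u)"
    using u by (simp add: emeasure_unit_measure Int_absorb2 atLeastLessThan_subset_iff)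
  also have "\<dots> = ennreal (1/2 - arctan ((x - \<beta>) / \<alpha>) / pi)" by (simp add: u_def)
  also have "\<dots> = (\<integral>\<^sup>+t. ennreal (\<alpha> / pi * (1 / (\<alpha>\<^sup>2 + (t - \<beta>)\<^sup>2))) * indicator {x..} t \<partial>lborel)"
  proof (rule nn_integral_FTC_atLeast[symmetric])
    fix t :: real
    have "1 + ((t - \<beta>) / \<alpha>)\<^sup>2 = (\<alpha>\<^sup>2 + (t - \<beta>)\<^sup>2) / \<alpha>\<^sup>2"
      using \<alpha> by (simp add: power_divide add_divide_distrib)
    then have eq: "inverse (1 + ((t - \<beta>) / \<alpha>)\<^sup>2) * (1 / \<alpha>) / pi = \<alpha> / pi * (1 / (\<alpha>\<^sup>2 + (t - \<beta>)\<^sup>2))"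
      using \<alpha> by (simp add: power2_eq_square inverse_eq_divide)
    have "((\<lambda>t. (t - \<beta>) / \<alpha>) has_real_derivative 1 / \<alpha>) (at t)"
      using \<alpha> by (auto intro!: derivative_eq_intros)
    then have "((\<lambda>t. arctan ((t - \<beta>) / \<alpha>)) has_real_derivative inverse (1 + ((t - \<beta>) / \<alpha>)\<^sup>2) * (1 / \<alpha>)) (at t)"
      by (rule DERIV_chain2[OF DERIV_arctan])
    then show "((\<lambda>t. arctan ((t - \<beta>) / \<alpha>) / pi) has_real_derivative \<alpha> / pi * (1 / (\<alpha>\<^sup>2 + (t - \<beta>)\<^sup>2))) (at t)"
      unfolding eq[symmetric] by (rule DERIV_cdivide)
    show "0 \<le> \<alpha> / pi * (1 / (\<alpha>\<^sup>2 + (t - \<beta>)\<^sup>2))" using \<alpha> by simp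
  next
    have "filterlim (\<lambda>t. (t - \<beta>) / \<alpha>) at_top at_top" using \<alpha> by real_asymp
    then have "((\<lambda>t. arctan ((t - \<beta>) / \<alpha>)) \<longlongrightarrow> pi / 2) at_top"
      by (rule filterlim_compose[OF tendsto_arctan_at_top])
    then have "((\<lambda>t. arctan ((t - \<beta>) / \<alpha>) / pi) \<longlongrightarrow> (pi / 2) / pi) at_top"
      by (rule tendsto_divide) auto
    then show "((\<lambda>t. arctan ((t - \<beta>) / \<alpha>) / pi) \<longlongrightarrow> 1 / 2) at_top" by simp
  qed simp
  also have "\<dots> = emeasure (boole_measure \<alpha> \<beta>) S"
    unfolding boole_measure_def S by (subst emeasure_density) auto
  finally show "emeasure (distr unit_measure borel (boole_coord \<alpha> \<beta>)) S = emeasure (boole_measure \<alpha> \<beta>) S" .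
qed auto

lemma AE_boole_measureI:
  assumes \<alpha>: "\<alpha> > 0" and P: "AE w in unit_measure. P (boole_coord \<alpha> \<beta> w)"
  shows "AE x in boole_measure \<alpha> \<beta>. P x"
proof -
  define W where "W = (\<lambda>x. 1/2 + arctan ((x - \<beta>) / \<alpha>) / pi)"
  have W [measurable]: "W \<in> borel_measurable borel" unfolding W_def by measurable
  have XW: "boole_coord \<alpha> \<beta> (W x) = x" for x
  proof -
    have "pi * W x - pi / 2 = arctan ((x - \<beta>) / \<alpha>)" by (simp add: W_def distrib_left)
    then have "cot (pi * W x) = - ((x - \<beta>) / \<alpha>)" using cot_eq_tan[of "W x"] by (simp add: tan_arctan)
    then show ?thesis using \<alpha> by (simp add: boole_coord_def)
  qed
  have WX: "W (boole_coord \<alpha> \<beta> w) = w" if "0 < w" "w < 1" for w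
  proof -
    have "pi * w < pi * 1" using that by (intro mult_strict_left_mono) auto
    then have "arctan (tan (pi * w - pi / 2)) = pi * w - pi / 2"
      using that by (intro arctan_tan) auto
    then show ?thesis using \<alpha> by (simp add: W_def boole_coord_def cot_eq_tan field_simps)
  qed
  have "distr (boole_measure \<alpha> \<beta>) borel W = distr unit_measure borel (W \<circ> boole_coord \<alpha> \<beta>)"
    unfolding distr_boole_coord[OF \<alpha>, symmetric] by (rule distr_distr) auto
  also have "\<dots> = distr unit_measure borel (\<lambda>w. w)"
    by (rule distr_cong_AE[OF refl refl]) (use AE_unit_measure_open in eventually_elim, use WX in auto)
  also have "\<dots> = unit_measure" by (rule distr_id2) simp
  finally have W_distr: "distr (boole_measure \<alpha> \<beta>) borel W = unit_measure" .
  have "AE w in distr (boole_measure \<alpha> \<beta>) borel W. P (boole_coord \<alpha> \<beta> w)"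
    unfolding W_distr by (rule P)
  then have "AE x in boole_measure \<alpha> \<beta>. P (boole_coord \<alpha> \<beta> (W x))"
    by (rule AE_distrD[rotated]) (simp add: boole_measure_def)
  then show ?thesis by (simp add: XW)
qed

text \<open>On the left half \<open>v \<le> pi v \<le> tan (pi v)\<close> bounds the cotangent by
  \<open>1 / v\<close>; the reflection of \<open>w\<close> to \<open>1 - w\<close> changes only its
  sign.\<close>

lemma abs_cot_le:
  assumes w: "0 < w" "w < 1"
  shows "\<bar>cot (pi * w)\<bar> \<le> 1 / w + 1 / (1 - w)"
proof -
  have half: "0 \<le> cot (pi * v) \<and> cot (pi * v) \<le> 1 / v" if v: "0 < v" "v \<le> 1/2" for v
  proof (cases "v = 1/2")
    case True
    show ?thesis unfolding True by (simp add: cot_def)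
  next
    case False
    then have t: "0 < pi * v" "pi * v < pi / 2" using v by (auto simp: field_simps)
    then have tp: "tan (pi * v) > 0" by (rule tan_gt_zero)
    have "1 * v \<le> pi * v" using v pi_gt3 by (intro mult_right_mono) auto
    also have "pi * v = arctan (tan (pi * v))" using t by (intro arctan_tan[symmetric]) linarith+
    also have "\<dots> \<le> tan (pi * v)" using tp by (intro arctan_le_self) simp
    finally have "v \<le> tan (pi * v)" by simp
    then show ?thesis using tp v by (simp add: cot_altdef inverse_eq_divide divide_left_mono)
  qed
  show ?thesis
  proof (cases "w \<le> 1/2")
    case True
    then have "0 \<le> cot (pi * w)" "cot (pi * w) \<le> 1 / w" using half[of w] w by auto
    moreover have "0 \<le> 1 / (1 - w)" using w by simp
    ultimately show ?thesis by linarith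
  next
    case False
    have "cot (pi * w) = - cot (pi * (1 - w))"
    proof -
      have "sin (pi * (1 - w)) = sin (pi * w)" "cos (pi * (1 - w)) = - cos (pi * w)"
        by (simp_all add: right_diff_distrib sin_diff cos_diff)
      then show ?thesis by (simp add: cot_def)
    qed
    moreover have "0 \<le> cot (pi * (1 - w))" "cot (pi * (1 - w)) \<le> 1 / (1 - w)"
      using half[of "1 - w"] w False by auto
    moreover have "0 \<le> 1 / w" using w by simp
    ultimately show ?thesis by linarith
  qed
qed

lemma powr_add_le:
  fixes a b e :: real
  assumes "a \<ge> 0" "b \<ge> 0" "0 \<le> e" "e \<le> 1"
  shows "(a + b) powr e \<le> 2 * (a powr e + b powr e)"
proof -
  have "(a + b) powr e \<le> (2 * max a b) powr e" using assms by (intro powr_mono2) auto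
  also have "\<dots> = 2 powr e * max a b powr e" by (rule powr_mult)
  also have "\<dots> \<le> 2 powr 1 * max a b powr e" using assms by (intro mult_right_mono powr_mono) auto
  also have "max a b powr e \<le> a powr e + b powr e" by (simp add: max_def)
  finally show ?thesis by simp
qed

text \<open>Growth of order \<open>e\<close> at infinity becomes a singularity of the same order at
  each end point of the unit interval, the form in which the digit estimates take it.\<close>

lemma boole_coord_growth:
  assumes \<alpha>: "\<alpha> > 0" and e: "0 \<le> e" "e \<le> 1"
  shows "\<exists>K>0. \<forall>w. 0 < w \<longrightarrow> w < 1 \<longrightarrow>
     (1 + \<bar>boole_coord \<alpha> \<beta> w\<bar>) powr e \<le> K * (w powr - e + (1 - w) powr - e)"
proof (intro exI[of _ "(1 + \<bar>\<beta>\<bar> + \<alpha>) powr e * 2"] conjI allI impI)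
  show "(1 + \<bar>\<beta>\<bar> + \<alpha>) powr e * 2 > 0" using \<alpha> by simp
  fix w :: real assume w: "0 < w" "w < 1"
  define s where "s = 1 / w + 1 / (1 - w)"
  have "1 \<le> 1 / w" "0 \<le> 1 / (1 - w)" using w by auto
  then have s: "s \<ge> 1" unfolding s_def by linarith
  have "\<bar>boole_coord \<alpha> \<beta> w\<bar> \<le> \<bar>\<beta>\<bar> + \<alpha> * \<bar>cot (pi * w)\<bar>"
    unfolding boole_coord_def using \<alpha> abs_triangle_ineq4[of \<beta> "\<alpha> * cot (pi * w)"] by (simp add: abs_mult)
  also have "\<alpha> * \<bar>cot (pi * w)\<bar> \<le> \<alpha> * s" unfolding s_def using abs_cot_le[OF w] \<alpha> by (intro mult_left_mono) auto
  finally have "1 + \<bar>boole_coord \<alpha> \<beta> w\<bar> \<le> 1 + \<bar>\<beta>\<bar> + \<alpha> * s" by simp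
  also have "\<dots> \<le> (1 + \<bar>\<beta>\<bar>) * s + \<alpha> * s"
    using s mult_left_mono[of 1 s "1 + \<bar>\<beta>\<bar>"] by simp
  also have "\<dots> = (1 + \<bar>\<beta>\<bar> + \<alpha>) * s" by (simp add: algebra_simps)
  finally have "(1 + \<bar>boole_coord \<alpha> \<beta> w\<bar>) powr e \<le> ((1 + \<bar>\<beta>\<bar> + \<alpha>) * s) powr e"
    using e by (intro powr_mono2) auto
  also have "\<dots> = (1 + \<bar>\<beta>\<bar> + \<alpha>) powr e * s powr e" by (rule powr_mult)
  also have "s powr e \<le> 2 * ((1 / w) powr e + (1 / (1 - w)) powr e)"
    unfolding s_def using w e by (intro powr_add_le) auto
  also have "(1 / w) powr e + (1 / (1 - w)) powr e = w powr - e + (1 - w) powr - e"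
    using w by (simp add: powr_divide powr_minus_divide)
  finally show "(1 + \<bar>boole_coord \<alpha> \<beta> w\<bar>) powr e \<le> (1 + \<bar>\<beta>\<bar> + \<alpha>) powr e * 2 * (w powr - e + (1 - w) powr - e)"
    by (simp add: mult_left_mono mult.assoc)
qed

lemma integrable_boole_measure_iff:
  fixes f :: "real \<Rightarrow> real"
  assumes \<alpha>: "\<alpha> > 0" and [measurable]: "f \<in> borel_measurable borel"
  shows "integrable unit_measure (\<lambda>w. f (boole_coord \<alpha> \<beta> w)) \<longleftrightarrow> integrable lborel (\<lambda>t. f t / (\<alpha>\<^sup>2 + (t - \<beta>)\<^sup>2))"
    and integral_boole_measure:
    "(\<integral>w. f (boole_coord \<alpha> \<beta> w) \<partial>unit_measure) = \<alpha> / pi * (LINT t|lborel. f t / (\<alpha>\<^sup>2 + (t - \<beta>)\<^sup>2))"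
proof -
  have nn: "0 \<le> \<alpha> / pi * (1 / (\<alpha>\<^sup>2 + (t - \<beta>)\<^sup>2))" for t using \<alpha> by simp
  have eq: "(\<alpha> / pi * (1 / (\<alpha>\<^sup>2 + (t - \<beta>)\<^sup>2))) *\<^sub>R f t = \<alpha> / pi * (f t / (\<alpha>\<^sup>2 + (t - \<beta>)\<^sup>2))" for t by simp
  have "integrable unit_measure (\<lambda>w. f (boole_coord \<alpha> \<beta> w)) \<longleftrightarrow> integrable (boole_measure \<alpha> \<beta>) f"
    unfolding distr_boole_coord[OF \<alpha>, symmetric] by (subst integrable_distr_eq) auto
  also have "\<dots> \<longleftrightarrow> integrable lborel (\<lambda>t. \<alpha> / pi * (f t / (\<alpha>\<^sup>2 + (t - \<beta>)\<^sup>2)))"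
    unfolding boole_measure_def eq[symmetric] by (rule integrable_density) (use nn in auto)
  also have "\<dots> \<longleftrightarrow> integrable lborel (\<lambda>t. f t / (\<alpha>\<^sup>2 + (t - \<beta>)\<^sup>2))"
    using \<alpha> by (simp only: integrable_mult_left_iff) simp
  finally show "integrable unit_measure (\<lambda>w. f (boole_coord \<alpha> \<beta> w)) \<longleftrightarrow> integrable lborel (\<lambda>t. f t / (\<alpha>\<^sup>2 + (t - \<beta>)\<^sup>2))" .
  have "(\<integral>w. f (boole_coord \<alpha> \<beta> w) \<partial>unit_measure) = (\<integral>x. f x \<partial>boole_measure \<alpha> \<beta>)"
    unfolding distr_boole_coord[OF \<alpha>, symmetric] by (subst integral_distr) auto
  also have "\<dots> = (LINT t|lborel. \<alpha> / pi * (f t / (\<alpha>\<^sup>2 + (t - \<beta>)\<^sup>2)))"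
    unfolding boole_measure_def eq[symmetric] by (rule integral_density) (use nn in auto)
  also have "\<dots> = \<alpha> / pi * (LINT t|lborel. f t / (\<alpha>\<^sup>2 + (t - \<beta>)\<^sup>2))" by (rule integral_mult_right_zero)
  finally show "(\<integral>w. f (boole_coord \<alpha> \<beta> w) \<partial>unit_measure) = \<alpha> / pi * (LINT t|lborel. f t / (\<alpha>\<^sup>2 + (t - \<beta>)\<^sup>2))".
qed

text \<open>The order 1/40 is the singularity that the digit estimates admit. Integrability and
  convergence are obtained in the coordinate \<open>w\<close> and carried back by the
  conjugacy.\<close>

lemma boole_averages_tendsto:
  fixes f :: "real \<Rightarrow> real"
  assumes \<alpha>: "\<alpha> > 0" and st: "stoltz n\<^sub>q k\<^sub>q" and cont: "continuous_on UNIV f"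
    and C: "C > 0" and f: "\<And>t. \<bar>f t\<bar> \<le> C * (1 + \<bar>t\<bar>) powr (1/40)"
  shows "integrable lborel (\<lambda>t. f t / (\<alpha>\<^sup>2 + (t - \<beta>)\<^sup>2))"
    "AE x in boole_measure \<alpha> \<beta>.
       (\<lambda>q. 1 / real (k\<^sub>q q) * (\<Sum>j=1..k\<^sub>q q. f ((boole_map \<alpha> \<beta> ^^ (n\<^sub>q q + j)) x)))
       \<longlonglongrightarrow> \<alpha> / pi * (LINT t|lborel. f t / (\<alpha>\<^sup>2 + (t - \<beta>)\<^sup>2))"
proof -
  define F where "F = (\<lambda>w. f (boole_coord \<alpha> \<beta> w))"
  have fm [measurable]: "f \<in> borel_measurable borel" using cont by (rule borel_measurable_continuous_onI)
  have Fm [measurable]: "F \<in> borel_measurable borel" unfolding F_def by measurable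
  have "continuous_on {0<..<1} (boole_coord \<alpha> \<beta>)"
    unfolding boole_coord_def[abs_def] cot_def
  proof (intro continuous_intros ballI)
    fix w :: real assume "w \<in> {0<..<1}"
    then have "0 < pi * w" "pi * w < pi" by auto
    then show "sin (pi * w) \<noteq> 0" using sin_gt_zero by force
  qed
  then have contF: "continuous_on {0<..<1} F"
    unfolding F_def by (rule continuous_on_compose2[OF cont]) simp
  obtain K where K: "K > 0" "\<And>w. 0 < w \<Longrightarrow> w < 1 \<Longrightarrow>
     (1 + \<bar>boole_coord \<alpha> \<beta> w\<bar>) powr (1/40) \<le> K * (w powr - (1/40) + (1 - w) powr - (1/40))"
    using boole_coord_growth[OF \<alpha>, of "1/40" \<beta>] by auto
  have F_le: "\<bar>F w\<bar> \<le> (C * K) * (w powr - (1/40) + (1 - w) powr - (1/40))" if "0 < w" "w < 1" for w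
  proof -
    have "\<bar>F w\<bar> \<le> C * (1 + \<bar>boole_coord \<alpha> \<beta> w\<bar>) powr (1/40)" unfolding F_def by (rule f)
    also have "\<dots> \<le> C * (K * (w powr - (1/40) + (1 - w) powr - (1/40)))"
      using C K(2)[OF that] by (intro mult_left_mono) auto
    finally show ?thesis by (simp only: mult.assoc)
  qed
  have "integrable unit_measure F"
  proof (rule Bochner_Integration.integrable_bound)
    show "integrable unit_measure (\<lambda>w. (C * K) * (w powr - (1/40) + (1 - w) powr - (1/40)))"
      using integrable_unit_measure_powr[of "1/40"] by simp
    show "AE w in unit_measure. norm (F w) \<le> norm ((C * K) * (w powr - (1/40) + (1 - w) powr - (1/40)))"
      using AE_unit_measure_open
    proof eventually_elim
      case (elim w)
      then show ?case using F_le[of w] by (simp add: abs_le_iff)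
    qed
  qed simp
  then show "integrable lborel (\<lambda>t. f t / (\<alpha>\<^sup>2 + (t - \<beta>)\<^sup>2))"
    unfolding F_def by (simp add: integrable_boole_measure_iff[OF \<alpha>])
  obtain N :: "nat \<Rightarrow> nat set" and A :: real where N: "\<And>k. finite (N k)"
    "\<And>k. real (card (N k)) \<le> A * (real k + 1)" "A > 0"
    "eventually (\<lambda>q. n\<^sub>q q \<in> N (k\<^sub>q q)) sequentially" "filterlim k\<^sub>q at_top sequentially"
    by (rule stoltz_index_sets[OF st], rule that)
  have "AE w in unit_measure. (\<lambda>q. 1 / real (k\<^sub>q q) * (\<Sum>j=1..k\<^sub>q q. F (frac (2 ^ (n\<^sub>q q + j) * w))))
     \<longlonglongrightarrow> (\<integral>w. F w \<partial>unit_measure)"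
    by (rule AE_averages_tendsto[OF Fm contF F_le _ N(1,2,3,4,5)]) (use C K in auto)
  then have "AE w in unit_measure.
     (\<lambda>q. 1 / real (k\<^sub>q q) * (\<Sum>j=1..k\<^sub>q q. f ((boole_map \<alpha> \<beta> ^^ (n\<^sub>q q + j)) (boole_coord \<alpha> \<beta> w))))
       \<longlonglongrightarrow> \<alpha> / pi * (LINT t|lborel. f t / (\<alpha>\<^sup>2 + (t - \<beta>)\<^sup>2))"
    by (simp only: F_def boole_coord_frac boole_map_iterate_coord[OF \<alpha>] integral_boole_measure[OF \<alpha> fm])
  then show "AE x in boole_measure \<alpha> \<beta>.
       (\<lambda>q. 1 / real (k\<^sub>q q) * (\<Sum>j=1..k\<^sub>q q. f ((boole_map \<alpha> \<beta> ^^ (n\<^sub>q q + j)) x)))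
       \<longlonglongrightarrow> \<alpha> / pi * (LINT t|lborel. f t / (\<alpha>\<^sup>2 + (t - \<beta>)\<^sup>2))"
    by (rule AE_boole_measureI[OF \<alpha>])
qed

theorem theorem7p3:
  fixes \<alpha> \<beta> :: real and n\<^sub>q k\<^sub>q :: "nat \<Rightarrow> nat" and k :: nat
  assumes "\<alpha> > 0" and "stoltz n\<^sub>q k\<^sub>q"
  shows "(\<forall>l::nat\<ge>1.
            integrable lborel
              (\<lambda>\<tau>. norm ((deriv ^^ k) zeta (Complex (1/2) \<tau>)) ^ l / (\<alpha>\<^sup>2 + (\<tau> - \<beta>)\<^sup>2)) \<and>
            (AE x in boole_measure \<alpha> \<beta>.
               (\<lambda>q. 1 / real (k\<^sub>q q) *
                  (\<Sum>j=1..k\<^sub>q q. norm ((deriv ^^ k) zeta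
                     (Complex (1/2) ((boole_map \<alpha> \<beta> ^^ (n\<^sub>q q + j)) x))) ^ l))
               \<longlonglongrightarrow>
               \<alpha> / pi * (LINT \<tau>|lborel.
                 norm ((deriv ^^ k) zeta (Complex (1/2) \<tau>)) ^ l / (\<alpha>\<^sup>2 + (\<tau> - \<beta>)\<^sup>2))))
         \<longleftrightarrow> Lindelof_Hypothesis"
proof
  assume "\<forall>l::nat\<ge>1. integrable lborel
              (\<lambda>\<tau>. norm ((deriv ^^ k) zeta (Complex (1/2) \<tau>)) ^ l / (\<alpha>\<^sup>2 + (\<tau> - \<beta>)\<^sup>2)) \<and>
            (AE x in boole_measure \<alpha> \<beta>.
               (\<lambda>q. 1 / real (k\<^sub>q q) *
                  (\<Sum>j=1..k\<^sub>q q. norm ((deriv ^^ k) zeta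
                     (Complex (1/2) ((boole_map \<alpha> \<beta> ^^ (n\<^sub>q q + j)) x))) ^ l))
               \<longlonglongrightarrow>
               \<alpha> / pi * (LINT \<tau>|lborel.
                 norm ((deriv ^^ k) zeta (Complex (1/2) \<tau>)) ^ l / (\<alpha>\<^sup>2 + (\<tau> - \<beta>)\<^sup>2)))"
  then show Lindelof_Hypothesis
    by (intro Lindelof_of_moments[OF assms(1), of k \<beta>]) simp
next
  assume LH: Lindelof_Hypothesis
  show "\<forall>l::nat\<ge>1. integrable lborel
              (\<lambda>\<tau>. norm ((deriv ^^ k) zeta (Complex (1/2) \<tau>)) ^ l / (\<alpha>\<^sup>2 + (\<tau> - \<beta>)\<^sup>2)) \<and>
            (AE x in boole_measure \<alpha> \<beta>.
               (\<lambda>q. 1 / real (k\<^sub>q q) *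
                  (\<Sum>j=1..k\<^sub>q q. norm ((deriv ^^ k) zeta
                     (Complex (1/2) ((boole_map \<alpha> \<beta> ^^ (n\<^sub>q q + j)) x))) ^ l))
               \<longlonglongrightarrow>
               \<alpha> / pi * (LINT \<tau>|lborel.
                 norm ((deriv ^^ k) zeta (Complex (1/2) \<tau>)) ^ l / (\<alpha>\<^sup>2 + (\<tau> - \<beta>)\<^sup>2)))"
  proof (intro allI impI)
    fix l :: nat assume l: "l \<ge> 1"
    let ?f = "\<lambda>\<tau>. norm ((deriv ^^ k) zeta (Complex (1/2) \<tau>)) ^ l"
    \<comment> \<open>The \<open>l\<close>-th power multiplies this exponent by \<open>l\<close>,
      which gives exactly 1/40.\<close>
    obtain C where C: "C > 0" "\<And>t. norm ((deriv ^^ k) zeta (Complex (1/2) t)) \<le> C * (1 + \<bar>t\<bar>) powr (1 / (40 * real l))"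
      using Lindelof_imp_growth[OF LH, of "1 / (40 * real l)" k] l by auto
    have cont: "continuous_on UNIV ?f"
      by (intro continuous_intros continuous_on_critical_line)
    have bound: "\<bar>?f t\<bar> \<le> C ^ l * (1 + \<bar>t\<bar>) powr (1/40)" for t
    proof -
      have "?f t \<le> (C * (1 + \<bar>t\<bar>) powr (1 / (40 * real l))) ^ l" by (intro power_mono C) simp
      also have "\<dots> = C ^ l * (1 + \<bar>t\<bar>) powr (1/40)"
        using l by (simp add: power_mult_distrib powr_power)
      finally show ?thesis by simp
    qed
    have "C ^ l > 0" using C by simp
    note main = boole_averages_tendsto[OF assms cont this bound, of \<beta>]
    show "integrable lborel (\<lambda>\<tau>. ?f \<tau> / (\<alpha>\<^sup>2 + (\<tau> - \<beta>)\<^sup>2)) \<and>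
       (AE x in boole_measure \<alpha> \<beta>.
               (\<lambda>q. 1 / real (k\<^sub>q q) *
                  (\<Sum>j=1..k\<^sub>q q. norm ((deriv ^^ k) zeta
                     (Complex (1/2) ((boole_map \<alpha> \<beta> ^^ (n\<^sub>q q + j)) x))) ^ l))
               \<longlonglongrightarrow>
               \<alpha> / pi * (LINT \<tau>|lborel.
                 norm ((deriv ^^ k) zeta (Complex (1/2) \<tau>)) ^ l / (\<alpha>\<^sup>2 + (\<tau> - \<beta>)\<^sup>2)))"
      by (intro conjI main)
  qed
qed

end
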